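(* Consider the modulated classical harmonic oscillator system $\frac{dx}{dt}=A_\epsilon(c,k,\phi)x$ described in the context, with equal modulation frequencies $a=b$ and with modulation period $T=2\pi a/|\alpha|$. Then the system with $c,k>0$ is posed at a first order asymptotic exceptional point if and only if $$k=1,\quad c\in(0,2)\quad\text{and}\quad\phi\in\left\{\mathrm{i}\log\left(\frac{2k}{\alpha+c}\right),\,-\mathrm{i}\log\left(\frac{2k}{\alpha-c}\right)\right\}\ (\text{modulo }2\pi).$$
   Context: Harmonic oscillator: for damping constant $c$, spring constant $k$ with $c^2\ne4k$, phase shift $\phi\in\mathbb{R}$, period $T>0$ and positive integers $a,b$ with $\gcd(a,b)=1$ (so $a=b$ means $a=b=1$), put $\alpha=\sqrt{c^2-4k}$ (with $\alpha=\mathrm{i}\sqrt{4k-c^2}$ if $c^2<4k$), $\zeta(t)=\cos(\frac{2\pi}{T}at)$, $\kappa(t)=\cos(\frac{2\pi}{T}bt+\phi)$, and $A_\epsilon=A_0+\epsilon A_1(t)$ with $$A_0=\begin{pmatrix}-\frac{c+\alpha}{2}&0\\0&-\frac{c-\alpha}{2}\end{pmatrix},\quad A_1(t)=\frac{\kappa(t)}{\alpha}\begin{pmatrix}1&\frac{(c+\alpha)^2}{4k}\\\frac{(c-\alpha)^2}{4k}&-1\end{pmatrix}+\frac{\zeta(t)}{2}\begin{pmatrix}-1-\frac{c}{\alpha}&-1-\frac{c}{\alpha}\\-1+\frac{c}{\alpha}&-1+\frac{c}{\alpha}\end{pmatrix}.$$ (This is the first order form, with diagonalized leading order, of $x''+(c+\epsilon\zeta(t))x'+(k+\epsilon\kappa(t))x=0$.)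 Let $F_0$ be the diagonal matrix with diagonal entries of $A_0-F_0$ in $\frac{2\pi \mathrm{i}}{T}\mathbb{Z}$ and imaginary parts of its diagonal entries in $(-\frac{\pi}{T},\frac{\pi}{T}]$. The fundamental solution has a decomposition $X_\epsilon(t)=P_\epsilon(t)\exp(F_\epsilon t)$, analytic in $\epsilon$ near $0$, with $P_\epsilon$ $T$-periodic in $t$, $P_\epsilon(0)=\mathrm{Id}$, $F_\epsilon=F_0+\epsilon F_1+\ldots$ and $P_\epsilon|_{\epsilon=0}(t)=\exp((A_0-F_0)t)$. The system is posed at a first order asymptotic exceptional point if $F_0+\epsilon F_1$ is not diagonalizable for all $\epsilon>0$. *)

theory Defs
  imports "HOL-Analysis.Analysis"
begin

section \<open>Matrices\<close>

(* On the type of square matrices the library operations * and ^ (hence also the power series of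
   exp) act entrywise, so the matrix exponential is written out with the matrix product **. *)
definition mat_exp :: "complex^'n^'n \<Rightarrow> complex^'n^'n" where
  "mat_exp M = (\<Sum>m. (1 / fact m) *\<^sub>R (((**) M ^^ m) (mat 1)))"

definition diagonal :: "complex^'n^'n \<Rightarrow> bool" where
  "diagonal M \<longleftrightarrow> (\<forall>i j. i \<noteq> j \<longrightarrow> M $ i $ j = 0)"

definition diagonalizable :: "complex^'n^'n \<Rightarrow> bool" where
  "diagonalizable M \<longleftrightarrow>
     (\<exists>(S :: complex^'n^'n) (D :: complex^'n^'n). invertible S \<and> diagonal D \<and> M = S ** D ** matrix_inv S)"


section \<open>Floquet decomposition of a perturbed linear periodic system\<close>

definition fundamental_solution ::
    "(real \<Rightarrow> complex^'n^'n) \<Rightarrow> (real \<Rightarrow> complex^'n^'n) \<Rightarrow> bool" where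
  "fundamental_solution A X \<longleftrightarrow>
     X 0 = mat 1 \<and> (\<forall>t. (X has_vector_derivative (A t ** X t)) (at t))"

definition folded_exponent :: "complex^'n^'n \<Rightarrow> real \<Rightarrow> complex^'n^'n \<Rightarrow> bool" where
  "folded_exponent A0 T F0 \<longleftrightarrow>
     diagonal F0 \<and>
     (\<forall>i. (\<exists>m::int. (A0 - F0) $ i $ i = 2 * of_real pi * \<i> / of_real T * of_int m) \<and>
          Im (F0 $ i $ i) \<in> {- pi / T <.. pi / T})"

(* The product P e t ** mat_exp (t *R F e) is the fundamental solution X_e(t) of x' = (A0 + e A1(t)) x.
   Analyticity near e = 0 is expressed with a complex parameter e in a disc that does not depend on
   t; mat e ** A1 t is the scalar multiple of A1 t by e. *)
definition floquet_decomposition ::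
    "complex^'n^'n \<Rightarrow> (real \<Rightarrow> complex^'n^'n) \<Rightarrow> real \<Rightarrow> complex^'n^'n \<Rightarrow>
     (complex \<Rightarrow> real \<Rightarrow> complex^'n^'n) \<Rightarrow> (complex \<Rightarrow> complex^'n^'n) \<Rightarrow> bool" where
  "floquet_decomposition A0 A1 T F0 P F \<longleftrightarrow>
     (\<exists>r>0.
        (\<forall>\<epsilon>\<in>ball 0 r.
           fundamental_solution (\<lambda>t. A0 + mat \<epsilon> ** A1 t) (\<lambda>t. P \<epsilon> t ** mat_exp (t *\<^sub>R F \<epsilon>)) \<and>
           (\<forall>t. P \<epsilon> (t + T) = P \<epsilon> t) \<and>
           P \<epsilon> 0 = mat 1) \<and>
        (\<forall>i j. (\<lambda>\<epsilon>. F \<epsilon> $ i $ j) holomorphic_on ball 0 r) \<and>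
        (\<forall>t i j. (\<lambda>\<epsilon>. P \<epsilon> t $ i $ j) holomorphic_on ball 0 r)) \<and>
     F 0 = F0 \<and>
     (\<forall>t. P 0 t = mat_exp (t *\<^sub>R (A0 - F0)))"

definition first_order_coeff :: "(complex \<Rightarrow> complex^'n^'n) \<Rightarrow> complex^'n^'n" where
  "first_order_coeff F = (\<chi> i j. deriv (\<lambda>\<epsilon>. F \<epsilon> $ i $ j) 0)"

(* F0 is determined by A0 and T.  Its eigenvalues do not differ by a nonzero multiple of 2 pi i / T,
   so exp is locally injective at T *R F0 and the germ of F at 0, hence the first order coefficient,
   is determined as well: the existential quantifier involves no choice. *)
definition first_order_asymptotic_EP ::
    "complex^'n^'n \<Rightarrow> (real \<Rightarrow> complex^'n^'n) \<Rightarrow> real \<Rightarrow> bool" where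
  "first_order_asymptotic_EP A0 A1 T \<longleftrightarrow>
     (\<exists>F0 P F. folded_exponent A0 T F0 \<and> floquet_decomposition A0 A1 T F0 P F \<and>
        (\<forall>\<epsilon>::real. \<epsilon> > 0 \<longrightarrow> \<not> diagonalizable (F0 + \<epsilon> *\<^sub>R first_order_coeff F)))"


section \<open>The modulated harmonic oscillator\<close>

(* csqrt is the principal root: for c^2 < 4k its value is i * sqrt (4k - c^2). *)
definition osc_alpha :: "real \<Rightarrow> real \<Rightarrow> complex" where
  "osc_alpha c k = csqrt (of_real (c\<^sup>2 - 4 * k))"

definition osc_zeta :: "nat \<Rightarrow> real \<Rightarrow> real \<Rightarrow> real" where
  "osc_zeta a T t = cos (2 * pi / T * real a * t)"

definition osc_kappa :: "nat \<Rightarrow> real \<Rightarrow> real \<Rightarrow> real \<Rightarrow> real" where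
  "osc_kappa b \<phi> T t = cos (2 * pi / T * real b * t + \<phi>)"

definition osc_A0 :: "real \<Rightarrow> real \<Rightarrow> complex^2^2" where
  "osc_A0 c k =
     (let \<alpha> = osc_alpha c k in
      vector [vector [- (of_real c + \<alpha>) / 2, 0],
              vector [0, - (of_real c - \<alpha>) / 2]])"

definition osc_A1 ::
    "real \<Rightarrow> real \<Rightarrow> real \<Rightarrow> nat \<Rightarrow> nat \<Rightarrow> real \<Rightarrow> real \<Rightarrow> complex^2^2" where
  "osc_A1 c k \<phi> a b T t =
     (let \<alpha> = osc_alpha c k; C = of_real c; K = of_real k in
      mat (of_real (osc_kappa b \<phi> T t) / \<alpha>) **
        vector [vector [1, (C + \<alpha>)\<^sup>2 / (4 * K)],
                vector [(C - \<alpha>)\<^sup>2 / (4 * K), - 1]]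
      + mat (of_real (osc_zeta a T t) / 2) **
        vector [vector [- 1 - C / \<alpha>, - 1 - C / \<alpha>],
                vector [- 1 + C / \<alpha>, - 1 + C / \<alpha>]])"

end

theory Submission
  imports Defs "HOL-Complex_Analysis.Conformal_Mappings"
begin

text \<open>
  Since \<open>a\<close> and \<open>b\<close> are equal and coprime, both are 1, and everything depends on the sign of
  \<open>c\<^sup>2 - 4 * k\<close>.

  If \<open>c\<^sup>2 > 4 * k\<close>, then \<open>\<alpha>\<close> is real, \<open>A\<^sub>0\<close> is already folded and \<open>F\<^sub>0 = A\<^sub>0\<close> has two distinct
  eigenvalues.  Distinct eigenvalues survive small perturbations, whatever the perturbation is, so
  \<open>F\<^sub>0 + \<epsilon> F\<^sub>1\<close> is diagonalizable for small \<open>\<epsilon> > 0\<close> (\<open>oscillator_overdamped\<close>).  The right hand side fails as well, because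
  \<open>k = 1\<close> and \<open>0 < c < 2\<close> force \<open>c\<^sup>2 < 4 * k\<close>.

  If \<open>c\<^sup>2 < 4 * k\<close>, then \<open>\<alpha> = \<i> \<omega>\<close> with \<open>\<omega> > 0\<close>, and \<open>T = 2 * pi / \<omega>\<close> is a period for which
  the two eigenvalues of \<open>A\<^sub>0\<close>, which differ by \<open>\<i> \<omega>\<close>, are folded onto the same number \<open>\<sigma>\<close>: the matrix
  \<open>F\<^sub>0\<close> is scalar (\<open>folded_exponent_underdamped\<close>).  Passing to \<open>Y = exp (- t A\<^sub>0) X\<close> turns the
  system into \<open>Y' = \<epsilon> B(t) Y\<close> with \<open>B(t) = exp (- t A\<^sub>0) A\<^sub>1(t) exp (t A\<^sub>0)\<close>.  Because \<open>F\<^sub>0\<close> is scalar, it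
  commutes with everything, so that \<open>F\<^sub>1\<close> is just the mean of \<open>B\<close> over a period
  (\<open>floquet_resonant\<close>).  In the mean only the products of equal frequencies survive: \<open>F\<^sub>1\<close> has
  zero diagonal and off-diagonal entries \<open>p\<close> and \<open>q\<close> (\<open>oscillator_resonant\<close>).  A scalar matrix plus a
  positive multiple of such a matrix is not diagonalizable if and only if exactly one of \<open>p\<close> and \<open>q\<close>
  vanishes.  Now \<open>p = 0\<close> says \<open>exp (\<i> \<phi>) = (c + \<alpha>) / (2 * k)\<close> and \<open>q = 0\<close> says
  \<open>exp (\<i> \<phi>) = 2 * k / (\<alpha> - c)\<close>.  Both right hand sides have modulus 1 only for \<open>k = 1\<close>, because
  \<open>c + \<alpha>\<close> and \<open>\<alpha> - c\<close> have modulus \<open>2 * sqrt k\<close>, and then they are opposite numbers, so \<open>p\<close> and \<open>q\<close>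
  do not vanish together.

  The definition asks for a Floquet decomposition that is holomorphic in \<open>\<epsilon>\<close>, and one has to be
  produced.  The solution \<open>Y\<close> is a power series in \<open>\<epsilon>\<close> whose coefficients are iterated primitives
  (\<open>linear_ode_parameter_series\<close>); it is entire in \<open>\<epsilon>\<close>, and its linear coefficient is the primitive of
  \<open>B\<close>.  What remains is a holomorphic logarithm of the family \<open>\<epsilon> \<mapsto> Y(T)\<close> near the identity
  (\<open>mat_log_holomorphic\<close>).  For 2 by 2 matrices the exponential has a closed form in terms of
  \<open>cosh (sqrt \<Delta>)\<close> and \<open>sinh (sqrt \<Delta>) / sqrt \<Delta>\<close>, which are entire functions of \<open>\<Delta>\<close>, and the logarithm is
  found by inverting the first of them near \<open>\<Delta> = 0\<close>.
\<close>

section \<open>Matrix algebra and calculus\<close>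

lemma bounded_bilinear_matrix_matrix_mult:
  "bounded_bilinear ((**) :: complex^'n^'m \<Rightarrow> complex^'p^'n \<Rightarrow> complex^'p^'m)"
  by (subst bilinear_conv_bounded_bilinear [symmetric])
     (simp add: bilinear_def linear_iff vec_eq_iff matrix_matrix_mult_def algebra_simps
        sum.distrib scaleR_sum_right)

lemma matrix_mult_norm_le:
  "\<exists>K>0. \<forall>(M :: complex^'n^'n) (N :: complex^'n^'n). norm (M ** N) \<le> norm M * norm N * K"
  using bounded_bilinear.pos_bounded [OF bounded_bilinear_matrix_matrix_mult] by blast

lemma matrix_add_rdistrib: "(A + B) ** C = A ** C + B ** (C :: complex^'n^'n)"
  by (rule bounded_bilinear.add_left [OF bounded_bilinear_matrix_matrix_mult])

lemma mat_nth: "mat c $ i $ j = (if i = j then c else 0)"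
  by (simp add: mat_def)

lemma mat_mult_component: "(mat c ** M) $ i $ j = (c :: complex) * M $ i $ j"
  by (simp add: matrix_matrix_mult_def mat_def if_distrib [of "\<lambda>x. x * _"] cong: if_cong)

lemma mult_mat_component: "(M ** mat c) $ i $ j = M $ i $ j * (c :: complex)"
  by (simp add: matrix_matrix_mult_def mat_def if_distrib [of "\<lambda>x. _ * x"] cong: if_cong)

lemma mat_mult_commute: "mat c ** M = M ** mat (c :: complex)"
  by (simp add: vec_eq_iff mat_mult_component mult_mat_component)

lemma mat_mult_mat: "mat c ** mat d = mat ((c :: complex) * d)"
  by (simp add: vec_eq_iff mat_mult_component) (simp add: mat_def)

lemma mat_mult_left_commute: "M ** (mat c ** N) = mat c ** (M ** (N :: complex^'n^'n))"
  by (simp add: matrix_mul_assoc mat_mult_commute [of c M])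

lemma mat_mult_mat_mult: "(mat a ** M) ** (mat b ** N) = mat (a * b) ** (M ** (N :: complex^'n^'n))"
  by (subst mat_mult_left_commute) (simp add: matrix_mul_assoc mat_mult_mat mult.commute)

lemma scaleR_matrix: "t *\<^sub>R M = mat (of_real t) ** (M :: complex^'n^'n)"
  by (simp add: vec_eq_iff mat_mult_component) (simp add: scaleR_conv_of_real)

lemma matrix2_eq_iff:
  "(M :: 'a^2^2) = N \<longleftrightarrow> M $ 1 $ 1 = N $ 1 $ 1 \<and> M $ 1 $ 2 = N $ 1 $ 2 \<and> M $ 2 $ 1 = N $ 2 $ 1 \<and> M $ 2 $ 2 = N $ 2 $ 2"
  by (auto simp: vec_eq_iff forall_2)

lemma matrix2_mult_nth: "(M ** N) $ i $ j = M $ i $ 1 * N $ 1 $ j + M $ i $ 2 * N $ 2 $ j"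
  for M N :: "complex^2^2"
  by (simp add: matrix_matrix_mult_def sum_2)

lemma sums_vec_iff: "f sums l \<longleftrightarrow> (\<forall>i. (\<lambda>n. f n $ i) sums (l $ i))"
  unfolding sums_def by (auto intro: vec_tendstoI dest: tendsto_vec_nth)

lemma has_vector_derivative_vecI:
  assumes "\<And>i. ((\<lambda>t. f t $ i) has_vector_derivative f' $ i) (at x)"
  shows "(f has_vector_derivative (f' :: 'a::real_normed_vector^'n)) (at x)"
proof -
  have "((\<lambda>y. ((f y - f x) - (y - x) *\<^sub>R f') /\<^sub>R norm (y - x)) \<longlongrightarrow> 0) (at x)"
  proof (rule vec_tendstoI)
    fix i
    have "((\<lambda>y. ((f y $ i - f x $ i) - (y - x) *\<^sub>R f' $ i) /\<^sub>R norm (y - x)) \<longlongrightarrow> 0) (at x)"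
      using assms [of i] by (simp add: has_vector_derivative_def has_derivative_at_within has_derivative_def)
    then show "((\<lambda>y. (((f y - f x) - (y - x) *\<^sub>R f') /\<^sub>R norm (y - x)) $ i) \<longlongrightarrow> 0 $ i) (at x)"
      by simp
  qed
  then show ?thesis
    by (simp add: has_vector_derivative_def has_derivative_def bounded_linear_scaleR_left)
qed

lemma has_vector_derivative_matrix_mult:
  fixes f g :: "real \<Rightarrow> complex^'n^'n"
  assumes "(f has_vector_derivative f') (at x)" "(g has_vector_derivative g') (at x)"
  shows "((\<lambda>t. f t ** g t) has_vector_derivative f x ** g' + f' ** g x) (at x)"
  using bounded_bilinear.has_vector_derivative [OF bounded_bilinear_matrix_matrix_mult assms] .

section \<open>Linear differential equations depending on a parameter\<close>

text \<open>
  Iterated integration against a bounded kernel gains a factor \<open>b * t / (n + 1)\<close> in each step.  The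
  hypotheses mention only the norm of the derivative, so the bound serves two purposes: the iterates
  may be different functions, which gives convergence of the Picard series, or all equal to one
  solution, which forces a solution with initial value zero to vanish.
\<close>

lemma picard_iterates_bound_nonneg:
  fixes Z :: "nat \<Rightarrow> real \<Rightarrow> 'a :: real_normed_vector"
  assumes deriv: "\<And>n t. \<bar>t\<bar> \<le> R \<Longrightarrow> (Z (Suc n) has_vector_derivative D n t) (at t)"
    and bound: "\<And>n t. \<bar>t\<bar> \<le> R \<Longrightarrow> norm (D n t) \<le> b * norm (Z n t)"
    and start: "\<And>n. Z (Suc n) 0 = 0"
    and first: "\<And>t. \<bar>t\<bar> \<le> R \<Longrightarrow> norm (Z 0 t) \<le> M"
    and "b \<ge> 0" and "0 \<le> t" and "t \<le> R"
  shows "norm (Z n t) \<le> M * (b * t) ^ n / fact n"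
  using \<open>0 \<le> t\<close> \<open>t \<le> R\<close>
proof (induction n arbitrary: t)
  case 0
  then show ?case using first by simp
next
  case (Suc n)
  show ?case
  proof (cases "t = 0")
    case True
    then show ?thesis by (simp add: start)
  next
    case False
    then have "0 < t" using Suc.prems by simp
    let ?\<phi> = "\<lambda>s. M * (b * s) ^ Suc n / fact (Suc n)"
    have \<phi>: "(?\<phi> has_vector_derivative b * (M * (b * s) ^ n / fact n)) (at s)" for s
    proof -
      have "(?\<phi> has_real_derivative M * (real (Suc n) * (b * s) ^ n * b) / fact (Suc n)) (at s)"
        by (rule derivative_eq_intros refl | simp)+
      also have "M * (real (Suc n) * (b * s) ^ n * b) / fact (Suc n)
                 = b * (M * (b * s) ^ n / fact n)"
        by (simp add: fact_Suc field_simps del: of_nat_Suc)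
      finally show ?thesis
        by (simp add: has_real_derivative_iff_has_vector_derivative)
    qed
    have "norm (Z (Suc n) t - Z (Suc n) 0) \<le> ?\<phi> t - ?\<phi> 0"
    proof (rule differentiable_bound_general [OF \<open>0 < t\<close>])
      show "continuous_on {0..t} (Z (Suc n))"
        using Suc.prems
        by (intro continuous_at_imp_continuous_on ballI
              has_vector_derivative_continuous [OF deriv]) auto
      show "continuous_on {0..t} ?\<phi>"
        by (intro continuous_intros) auto
      show "(Z (Suc n) has_vector_derivative D n s) (at s)" if "0 < s" "s < t" for s
        using that Suc.prems by (intro deriv) auto
      show "(?\<phi> has_vector_derivative b * (M * (b * s) ^ n / fact n)) (at s)" for s
        by (rule \<phi>)
      show "norm (D n s) \<le> b * (M * (b * s) ^ n / fact n)" if "0 < s" "s < t" for s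
      proof -
        have "norm (D n s) \<le> b * norm (Z n s)"
          using that Suc.prems by (intro bound) auto
        also have "\<dots> \<le> b * (M * (b * s) ^ n / fact n)"
          using that Suc.prems \<open>b \<ge> 0\<close> by (intro mult_left_mono Suc.IH) auto
        finally show ?thesis .
      qed
    qed
    then show ?thesis by (simp add: start)
  qed
qed

text \<open>
  Negative times follow by the reflection \<open>t \<mapsto> - t\<close>.
\<close>

lemma picard_iterates_bound:
  fixes Z :: "nat \<Rightarrow> real \<Rightarrow> 'a :: real_normed_vector"
  assumes deriv: "\<And>n t. \<bar>t\<bar> \<le> R \<Longrightarrow> (Z (Suc n) has_vector_derivative D n t) (at t)"
    and bound: "\<And>n t. \<bar>t\<bar> \<le> R \<Longrightarrow> norm (D n t) \<le> b * norm (Z n t)"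
    and start: "\<And>n. Z (Suc n) 0 = 0"
    and first: "\<And>t. \<bar>t\<bar> \<le> R \<Longrightarrow> norm (Z 0 t) \<le> M"
    and "b \<ge> 0" and t: "\<bar>t\<bar> \<le> R"
  shows "norm (Z n t) \<le> M * (b * \<bar>t\<bar>) ^ n / fact n"
proof (cases "t \<ge> 0")
  case True
  then show ?thesis
    using picard_iterates_bound_nonneg [of R Z D b M t n] assms by simp
next
  case False
  have "norm (Z n (- (- t))) \<le> M * (b * (- t)) ^ n / fact n"
  proof (rule picard_iterates_bound_nonneg [where Z = "\<lambda>n s. Z n (- s)" and D = "\<lambda>n s. - D n (- s)"
        and R = R])
    fix n :: nat and s :: real assume "\<bar>s\<bar> \<le> R"
    then have "(Z (Suc n) has_vector_derivative D n (- s)) (at (- s))"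
      by (intro deriv) simp
    then have "((Z (Suc n) \<circ> uminus) has_vector_derivative - 1 *\<^sub>R D n (- s)) (at s)"
      by (intro vector_diff_chain_at) (auto intro!: derivative_eq_intros)
    then show "((\<lambda>s. Z (Suc n) (- s)) has_vector_derivative - D n (- s)) (at s)"
      by (simp add: o_def)
  qed (use assms False in \<open>auto\<close>)
  with False show ?thesis by simp
qed

lemma norm_bound_compact:
  fixes f :: "real \<Rightarrow> 'a :: real_normed_vector"
  assumes "continuous_on UNIV f"
  obtains b where "b \<ge> 0" "\<And>t. \<bar>t\<bar> \<le> R \<Longrightarrow> norm (f t) \<le> b"
proof -
  have "compact (f ` {-R..R})"
    using assms by (intro compact_continuous_image) (auto intro: continuous_on_subset)
  then obtain b where "\<And>x. x \<in> f ` {-R..R} \<Longrightarrow> norm x \<le> b"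
    using compact_imp_bounded bounded_iff by metis
  then have "\<And>t. \<bar>t\<bar> \<le> R \<Longrightarrow> norm (f t) \<le> max b 0"
    by (metis abs_le_iff atLeastAtMost_iff imageI max.coboundedI1 minus_le_iff)
  then show ?thesis using that by (metis max.cobounded2)
qed

text \<open>
  The difference \<open>W\<close> of the two solutions is a Picard iterate of itself, hence bounded by
  \<open>M * x ^ n / fact n\<close> for every \<open>n\<close>.
\<close>

lemma linear_ode_unique:
  fixes A U V :: "real \<Rightarrow> complex^'n^'n"
  assumes cont: "continuous_on UNIV A"
    and U: "\<And>t. (U has_vector_derivative A t ** U t) (at t)"
    and V: "\<And>t. (V has_vector_derivative A t ** V t) (at t)"
    and "U 0 = V 0"
  shows "U t = V t"
proof -
  define W where "W = (\<lambda>t. U t - V t)"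
  have W: "(W has_vector_derivative A t ** W t) (at t)" for t
    unfolding W_def using has_vector_derivative_diff [OF U V]
    by (simp add: bounded_bilinear.diff_right [OF bounded_bilinear_matrix_matrix_mult])
  then have "continuous_on UNIV W"
    by (intro continuous_at_imp_continuous_on ballI has_vector_derivative_continuous)
  then obtain M where M: "M \<ge> 0" "\<And>s. \<bar>s\<bar> \<le> \<bar>t\<bar> \<Longrightarrow> norm (W s) \<le> M"
    using norm_bound_compact [of W "\<bar>t\<bar>"] by metis
  obtain a where a: "a \<ge> 0" "\<And>s. \<bar>s\<bar> \<le> \<bar>t\<bar> \<Longrightarrow> norm (A s) \<le> a"
    using norm_bound_compact [OF cont, of "\<bar>t\<bar>"] by metis
  obtain K where K: "K > 0"
    "\<And>(M :: complex^'n^'n) (N :: complex^'n^'n). norm (M ** N) \<le> norm M * norm N * K"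
    using matrix_mult_norm_le by blast
  have "norm (W t) \<le> M * (a * K * \<bar>t\<bar>) ^ n / fact n" for n
  proof (rule picard_iterates_bound [where Z = "\<lambda>n. W" and D = "\<lambda>n s. A s ** W s" and R = "\<bar>t\<bar>"])
    fix s assume "\<bar>s\<bar> \<le> \<bar>t\<bar>"
    have "norm (A s ** W s) \<le> norm (A s) * norm (W s) * K" by (rule K)
    also have "\<dots> \<le> a * norm (W s) * K"
      using a(2) [OF \<open>\<bar>s\<bar> \<le> \<bar>t\<bar>\<close>] K(1) by (intro mult_right_mono) auto
    finally show "norm (A s ** W s) \<le> a * K * norm (W s)" by (simp add: mult_ac)
  qed (use W M a K \<open>U 0 = V 0\<close> in \<open>auto simp: W_def\<close>)
  moreover have "(\<lambda>n. M * (a * K * \<bar>t\<bar>) ^ n / fact n) \<longlonglongrightarrow> 0"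
  proof -
    have "(\<lambda>n. M * (inverse (fact n) * (a * K * \<bar>t\<bar>) ^ n)) \<longlonglongrightarrow> 0"
      by (intro tendsto_mult_right_zero summable_LIMSEQ_zero [OF summable_exp])
    then show ?thesis by (simp add: field_simps)
  qed
  ultimately have "norm (W t) \<le> 0"
    by (intro LIMSEQ_le_const) auto
  then show ?thesis by (simp add: W_def)
qed

lemma has_vector_derivative_suminf:
  fixes f :: "nat \<Rightarrow> real \<Rightarrow> 'a :: banach"
  assumes "open S" "convex S"
    and deriv: "\<And>n t. t \<in> S \<Longrightarrow> (f n has_vector_derivative f' n t) (at t)"
    and bound: "\<And>n t. t \<in> S \<Longrightarrow> norm (f' n t) \<le> M n" and "summable M"
    and sums: "\<And>t. t \<in> S \<Longrightarrow> summable (\<lambda>n. f n t)" and t: "t \<in> S"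
  shows "((\<lambda>t. \<Sum>n. f n t) has_vector_derivative (\<Sum>n. f' n t)) (at t)"
proof -
  have lim: "uniform_limit S (\<lambda>n t. \<Sum>i<n. f' i t) (\<lambda>t. \<Sum>i. f' i t) sequentially"
    using bound \<open>summable M\<close> by (rule Weierstrass_m_test)
  have "\<exists>g. \<forall>s\<in>S. (\<lambda>n. f n s) sums g s
          \<and> (g has_derivative (\<lambda>h. h *\<^sub>R (\<Sum>i. f' i s))) (at s within S)"
  proof (rule has_derivative_series [where f' = "\<lambda>n s h. h *\<^sub>R f' n s"])
    show "(f n has_derivative (\<lambda>h. h *\<^sub>R f' n s)) (at s within S)" if "s \<in> S" for n s
      using deriv [OF that] by (auto simp: has_vector_derivative_def intro: has_derivative_at_withinI)
    show "\<forall>\<^sub>F n in sequentially. \<forall>x\<in>S. \<forall>h.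
        norm ((\<Sum>i<n. h *\<^sub>R f' i x) - h *\<^sub>R (\<Sum>i. f' i x)) \<le> e * norm h" if "e > 0" for e
      using uniform_limitD [OF lim that]
    proof eventually_elim
      case (elim n)
      show ?case
      proof (intro ballI allI)
        fix x h assume "x \<in> S"
        have "norm ((\<Sum>i<n. h *\<^sub>R f' i x) - h *\<^sub>R (\<Sum>i. f' i x))
              = \<bar>h\<bar> * norm ((\<Sum>i<n. f' i x) - (\<Sum>i. f' i x))"
          by (simp flip: scaleR_sum_right scaleR_diff_right)
        also have "\<dots> \<le> \<bar>h\<bar> * e"
          using elim \<open>x \<in> S\<close> by (intro mult_left_mono) (auto simp: dist_norm intro: less_imp_le)
        finally show "norm ((\<Sum>i<n. h *\<^sub>R f' i x) - h *\<^sub>R (\<Sum>i. f' i x)) \<le> e * norm h"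
          by (simp add: mult.commute)
      qed
    qed
  qed (use assms summable_sums in auto)
  then obtain g where g: "\<And>s. s \<in> S \<Longrightarrow> (\<lambda>n. f n s) sums g s"
      "\<And>s. s \<in> S \<Longrightarrow> (g has_derivative (\<lambda>h. h *\<^sub>R (\<Sum>i. f' i s))) (at s within S)"
    by blast
  have "(g has_derivative (\<lambda>h. h *\<^sub>R (\<Sum>i. f' i t))) (at t)"
    using g(2) [OF t] at_within_open [OF t \<open>open S\<close>] by simp
  then have "((\<lambda>t. \<Sum>n. f n t) has_derivative (\<lambda>h. h *\<^sub>R (\<Sum>i. f' i t))) (at t)"
    by (rule has_derivative_transform_within_open [OF _ \<open>open S\<close> t]) (use g(1) sums_unique in auto)
  then show ?thesis by (simp add: has_vector_derivative_def)
qed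

text \<open>
  The ansatz \<open>Y = (\<Sum>n. \<epsilon> ^ n y\<^sub>n(t))\<close> solves \<open>Y' = \<epsilon> B Y\<close> with \<open>Y(0) = Id\<close> once \<open>y\<^sub>0\<close> is the identity and each
  \<open>y\<^sub>n\<^sub>+\<^sub>1\<close> is the primitive of \<open>B y\<^sub>n\<close> that vanishes at 0.  The factorial bounds make the series converge
  for every \<open>\<epsilon>\<close>, locally uniformly in \<open>t\<close>, so that it is entire in \<open>\<epsilon>\<close> and may be differentiated
  termwise in \<open>t\<close>.  Its linear coefficient \<open>Y1 = y\<^sub>1\<close> is the primitive of \<open>B\<close> itself.
\<close>

lemma linear_ode_parameter_series:
  fixes B :: "real \<Rightarrow> complex^'n^'n"
  assumes cont: "continuous_on UNIV B"
  obtains Y :: "complex \<Rightarrow> real \<Rightarrow> complex^'n^'n" and Y1 :: "real \<Rightarrow> complex^'n^'n"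
  where "\<forall>\<epsilon>. fundamental_solution (\<lambda>t. mat \<epsilon> ** B t) (Y \<epsilon>)"
    and "\<forall>t. Y 0 t = mat 1"
    and "\<forall>t i j. (\<lambda>\<epsilon>. Y \<epsilon> t $ i $ j) holomorphic_on UNIV"
    and "\<forall>t i j. ((\<lambda>\<epsilon>. Y \<epsilon> t $ i $ j) has_field_derivative (Y1 t $ i $ j)) (at 0)"
    and "Y1 0 = 0" "\<forall>t. (Y1 has_vector_derivative B t) (at t)"
proof -
  have prim: "\<exists>F. F 0 = 0 \<and> (\<forall>t. (F has_vector_derivative f t) (at t))"
    if "continuous_on UNIV f" for f :: "real \<Rightarrow> complex^'n^'n"
  proof -
    have "\<exists>F. \<forall>t. - \<infinity> < ereal t \<longrightarrow> ereal t < \<infinity> \<longrightarrow> (F has_vector_derivative f t) (at t)"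
      using that by (intro einterval_antiderivative) (auto simp: continuous_on_eq_continuous_at)
    then obtain F where F: "\<And>t. (F has_vector_derivative f t) (at t)" by auto
    have "((\<lambda>t. F t - F 0) has_vector_derivative f t) (at t)" for t
      using has_vector_derivative_diff [OF F has_vector_derivative_const] by simp
    then show ?thesis by (intro exI [of _ "\<lambda>t. F t - F 0"]) auto
  qed
  have "\<exists>y :: nat \<Rightarrow> real \<Rightarrow> complex^'n^'n. \<forall>n.
          (continuous_on UNIV (y n) \<and> (n = 0 \<longrightarrow> y n = (\<lambda>t. mat 1))) \<and>
          (y (Suc n) 0 = 0 \<and> (\<forall>t. (y (Suc n) has_vector_derivative B t ** y n t) (at t)))"
  proof (rule dependent_nat_choice)
    show "\<exists>x. continuous_on UNIV x \<and> (0 = 0 \<longrightarrow> x = (\<lambda>t. mat 1 :: complex^'n^'n))"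
      by (intro exI [of _ "\<lambda>t. mat 1"]) auto
  next
    fix x :: "real \<Rightarrow> complex^'n^'n" and n :: nat
    assume x: "continuous_on UNIV x \<and> (n = 0 \<longrightarrow> x = (\<lambda>t. mat 1))"
    then have "continuous_on UNIV (\<lambda>t. B t ** x t)"
      by (intro bounded_bilinear.continuous_on [OF bounded_bilinear_matrix_matrix_mult] cont) auto
    from prim [OF this] obtain F
      where "F 0 = 0" "\<And>t. (F has_vector_derivative B t ** x t) (at t)"
      by blast
    moreover from this have "continuous_on UNIV F"
      by (intro continuous_at_imp_continuous_on ballI has_vector_derivative_continuous)
    ultimately show "\<exists>y. (continuous_on UNIV y \<and> (Suc n = 0 \<longrightarrow> y = (\<lambda>t. mat 1))) \<and>
        (y 0 = 0 \<and> (\<forall>t. (y has_vector_derivative B t ** x t) (at t)))"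
      using \<open>F 0 = 0\<close> by (intro exI [of _ F] conjI allI impI) simp_all
  qed
  then obtain y :: "nat \<Rightarrow> real \<Rightarrow> complex^'n^'n" where
    all: "\<forall>n.
          (continuous_on UNIV (y n) \<and> (n = 0 \<longrightarrow> y n = (\<lambda>t. mat 1))) \<and>
          (y (Suc n) 0 = 0 \<and> (\<forall>t. (y (Suc n) has_vector_derivative B t ** y n t) (at t)))"
    by (elim exE)
  have y0: "y 0 t = mat 1" and ySuc0: "y (Suc n) 0 = 0" and
    y: "(y (Suc n) has_vector_derivative B t ** y n t) (at t)" for n t
    using all by simp_all
  \<comment> \<open>For fixed \<open>\<epsilon>\<close> the summands \<open>Z\<close> are the Picard iterates of the equation with right hand side \<open>\<epsilon> B Y\<close>.\<close>
  define Z where "Z = (\<lambda>\<epsilon> n t. mat (\<epsilon> ^ n) ** y n t)"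
  define D where "D = (\<lambda>\<epsilon> n t. (mat \<epsilon> ** B t) ** Z \<epsilon> n t)"
  define Y where "Y = (\<lambda>\<epsilon> t. \<Sum>n. Z \<epsilon> n t)"
  note mult_right = bounded_bilinear.bounded_linear_right [OF bounded_bilinear_matrix_matrix_mult]
  have Z_deriv: "(Z \<epsilon> (Suc n) has_vector_derivative D \<epsilon> n t) (at t)" for \<epsilon> n t
  proof -
    have "(Z \<epsilon> (Suc n) has_vector_derivative mat (\<epsilon> ^ Suc n) ** (B t ** y n t)) (at t)"
      unfolding Z_def by (rule bounded_linear.has_vector_derivative [OF mult_right y])
    also have "mat (\<epsilon> ^ Suc n) ** (B t ** y n t) = D \<epsilon> n t"
      unfolding D_def Z_def 
      by (subst mat_mult_left_commute) (simp add: matrix_mul_assoc mat_mult_mat mult.commute)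
    finally show ?thesis .
  qed
  obtain K where K: "K > 0"
    "\<And>(M :: complex^'n^'n) (N :: complex^'n^'n). norm (M ** N) \<le> norm M * norm N * K"
    using matrix_mult_norm_le by blast
  have bounds: "\<exists>b\<ge>0. \<forall>t. \<bar>t\<bar> \<le> R \<longrightarrow> (\<forall>n. norm (D \<epsilon> n t) \<le> b * norm (Z \<epsilon> n t) \<and>
      norm (Z \<epsilon> n t) \<le> norm (mat 1 :: complex^'n^'n) * (b * R) ^ n / fact n)" for R \<epsilon>
  proof -
    have "continuous_on UNIV (\<lambda>t. mat \<epsilon> ** B t)"
      by (intro bounded_linear.continuous_on [OF mult_right] cont)
    then obtain a where a: "a \<ge> 0" "\<And>s. \<bar>s\<bar> \<le> R \<Longrightarrow> norm (mat \<epsilon> ** B s) \<le> a"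
      using norm_bound_compact [of "\<lambda>t. mat \<epsilon> ** B t" R] by metis
    have D: "norm (D \<epsilon> n t) \<le> a * K * norm (Z \<epsilon> n t)" if "\<bar>t\<bar> \<le> R" for n t
    proof -
      have "norm (D \<epsilon> n t) \<le> norm (mat \<epsilon> ** B t) * norm (Z \<epsilon> n t) * K"
        unfolding D_def by (rule K)
      also have "\<dots> \<le> a * norm (Z \<epsilon> n t) * K"
        using a(2) [OF that] K(1) by (intro mult_right_mono) auto
      finally show ?thesis by (simp add: mult_ac)
    qed
    have "norm (Z \<epsilon> n t) \<le> norm (mat 1 :: complex^'n^'n) * (a * K * \<bar>t\<bar>) ^ n / fact n"
      if "\<bar>t\<bar> \<le> R" for n t
    proof (rule picard_iterates_bound [where Z = "Z \<epsilon>" and D = "D \<epsilon>" and R = R])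
      show "Z \<epsilon> (Suc n) 0 = 0" for n
        by (simp add: Z_def ySuc0 bounded_bilinear.zero_right [OF bounded_bilinear_matrix_matrix_mult])
    qed (use a K that D Z_deriv in \<open>auto simp: Z_def y0\<close>)
    moreover have "norm (mat 1 :: complex^'n^'n) * (a * K * \<bar>t\<bar>) ^ n / fact n
        \<le> norm (mat 1 :: complex^'n^'n) * (a * K * R) ^ n / fact n" if "\<bar>t\<bar> \<le> R" for n t
      using that a K by (intro divide_right_mono mult_left_mono power_mono) auto
    ultimately show ?thesis
      using D a K by (intro exI [of _ "a * K"]) (fastforce intro: order_trans)
  qed
  have majorant: "summable (\<lambda>n. m * x ^ n / fact n)" for m x :: real
    using summable_mult [OF summable_exp [of x], of m] by (simp add: field_simps)
  have Z_summable: "summable (\<lambda>n. Z \<epsilon> n t)" for \<epsilon> t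
  proof -
    obtain b where "\<forall>n. norm (Z \<epsilon> n t) \<le> norm (mat 1 :: complex^'n^'n) * (b * \<bar>t\<bar>) ^ n / fact n"
      using bounds [of "\<bar>t\<bar>" \<epsilon>] by auto
    then show ?thesis by (intro summable_comparison_test' [OF majorant]) auto
  qed
  have Y_deriv: "(Y \<epsilon> has_vector_derivative (mat \<epsilon> ** B t) ** Y \<epsilon> t) (at t)" for \<epsilon> t
  proof -
    define R where "R = \<bar>t\<bar> + 1"
    obtain b where b: "b \<ge> 0" "\<And>t n. \<bar>t\<bar> \<le> R \<Longrightarrow> norm (D \<epsilon> n t) \<le> b * norm (Z \<epsilon> n t)"
      "\<And>t n. \<bar>t\<bar> \<le> R \<Longrightarrow> norm (Z \<epsilon> n t) \<le> norm (mat 1 :: complex^'n^'n) * (b * R) ^ n / fact n"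
      using bounds [of R \<epsilon>] by blast
    have D_bound: "norm (D \<epsilon> n s) \<le> b * (norm (mat 1 :: complex^'n^'n) * (b * R) ^ n / fact n)"
      if "\<bar>s\<bar> \<le> R" for n s
      using b(2) [OF that] mult_left_mono [OF b(3) [OF that] b(1)] by (rule order_trans)
    have "((\<lambda>t. \<Sum>n. Z \<epsilon> (Suc n) t) has_vector_derivative (\<Sum>n. D \<epsilon> n t)) (at t)"
    proof (rule has_vector_derivative_suminf [where S = "{-R<..<R}"])
      show "summable (\<lambda>n. b * (norm (mat 1 :: complex^'n^'n) * (b * R) ^ n / fact n))"
        by (intro summable_mult majorant)
      show "norm (D \<epsilon> n s) \<le> b * (norm (mat 1 :: complex^'n^'n) * (b * R) ^ n / fact n)"
        if "s \<in> {-R<..<R}" for n s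
        using that by (intro D_bound) auto
      show "summable (\<lambda>n. Z \<epsilon> (Suc n) s)" for s
        using Z_summable by (subst summable_Suc_iff)
    qed (use Z_deriv in \<open>auto simp: R_def\<close>)
    moreover have "Y \<epsilon> = (\<lambda>t. mat 1 + (\<Sum>n. Z \<epsilon> (Suc n) t))"
      using suminf_split_head [OF Z_summable] by (auto simp: Y_def Z_def y0 fun_eq_iff)
    moreover have "(\<Sum>n. D \<epsilon> n t) = (mat \<epsilon> ** B t) ** Y \<epsilon> t"
      unfolding D_def Y_def by (rule bounded_linear.suminf [OF mult_right Z_summable, symmetric])
    ultimately show ?thesis
      using has_vector_derivative_add [OF has_vector_derivative_const [of "mat 1"]] by fastforce
  qed
  have Y_start: "Y \<epsilon> 0 = mat 1" for \<epsilon>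
  proof -
    have "Z \<epsilon> (Suc n) 0 = 0" for n
      by (simp add: Z_def ySuc0 bounded_bilinear.zero_right [OF bounded_bilinear_matrix_matrix_mult])
    then show ?thesis
      using suminf_split_head [OF Z_summable, of \<epsilon> 0] by (simp add: Y_def) (simp add: Z_def y0)
  qed
  have Z_nth: "Z \<epsilon> n t $ i $ j = y n t $ i $ j * \<epsilon> ^ n" for \<epsilon> n t i j
    by (simp add: Z_def mat_mult_component)
  \<comment> \<open>Read entrywise, the same series is a power series in \<open>\<epsilon>\<close> that converges everywhere.\<close>
  have Y_sums: "(\<lambda>n. y n t $ i $ j * \<epsilon> ^ n) sums (Y \<epsilon> t $ i $ j)" for \<epsilon> t i j
    using sums_vec_nth [OF sums_vec_nth [OF summable_sums [OF Z_summable [of \<epsilon> t]]]]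
    by (simp add: Y_def Z_nth)
  have Y_field_deriv: "((\<lambda>\<epsilon>. Y \<epsilon> t $ i $ j) has_field_derivative
      (\<Sum>n. diffs (\<lambda>n. y n t $ i $ j) n * \<epsilon> ^ n)) (at \<epsilon>)" for \<epsilon> t i j
  proof -
    have "((\<lambda>\<epsilon>. \<Sum>n. y n t $ i $ j * \<epsilon> ^ n) has_field_derivative
      (\<Sum>n. diffs (\<lambda>n. y n t $ i $ j) n * \<epsilon> ^ n)) (at \<epsilon>)"
      using Y_sums by (intro termdiffs_strong_converges_everywhere) (auto simp: sums_iff)
    then show ?thesis using Y_sums by (simp add: sums_iff)
  qed
  show ?thesis
  proof (rule that [of Y "y 1"])
    show "\<forall>\<epsilon>. fundamental_solution (\<lambda>t. mat \<epsilon> ** B t) (Y \<epsilon>)"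
      unfolding fundamental_solution_def using Y_start Y_deriv by blast
    show "\<forall>t. Y 0 t = mat 1"
      using Y_sums [of _ _ _ 0] by (simp add: vec_eq_iff sums_iff powser_zero y0)
    show "\<forall>t i j. (\<lambda>\<epsilon>. Y \<epsilon> t $ i $ j) holomorphic_on UNIV"
      unfolding holomorphic_on_def field_differentiable_def using Y_field_deriv by blast
    show "\<forall>t i j. ((\<lambda>\<epsilon>. Y \<epsilon> t $ i $ j) has_field_derivative (y 1 t $ i $ j)) (at 0)"
      using Y_field_deriv [of _ _ _ 0] by (simp add: powser_zero diffs_def)
    show "y 1 0 = 0" using ySuc0 by simp
    show "\<forall>t. (y 1 has_vector_derivative B t) (at t)"
      using y [of 0] by (simp add: y0)
  qed
qed

section \<open>Hyperbolic functions of a square root\<close>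

text \<open>
  The quotient \<open>sinh w / w\<close> is even in \<open>w\<close>, hence a function of \<open>w\<^sup>2\<close>; the value at 0 is the limit, which
  makes the function entire.
\<close>

definition sinhc_sqrt :: "complex \<Rightarrow> complex" where
  "sinhc_sqrt z = (if z = 0 then 1 else sinh (csqrt z) / csqrt z)"

text \<open>
  The value does not depend on the choice of the square root, because \<open>cosh\<close> is even.
\<close>

definition cosh_sqrt :: "complex \<Rightarrow> complex" where
  "cosh_sqrt z = cosh (csqrt z)"

lemma csqrt_power2_cases: "csqrt (w\<^sup>2) = w \<or> csqrt (w\<^sup>2) = - w"
  by (metis power2_csqrt power2_eq_iff)

lemma cosh_sqrt_power2: "cosh_sqrt (w\<^sup>2) = cosh w"
  using csqrt_power2_cases [of w] by (auto simp: cosh_sqrt_def)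

lemma sinhc_sqrt_power2: "w * sinhc_sqrt (w\<^sup>2) = sinh w"
  using csqrt_power2_cases [of w] by (auto simp: sinhc_sqrt_def)

lemma sinhc_sqrt_0 [simp]: "sinhc_sqrt 0 = 1"
  by (simp add: sinhc_sqrt_def)

lemma cosh_sqrt_0 [simp]: "cosh_sqrt 0 = 1"
  by (simp add: cosh_sqrt_def)

lemma cosh_sqrt_square: "cosh_sqrt z ^ 2 - z * sinhc_sqrt z ^ 2 = 1"
proof -
  have "z * sinhc_sqrt z ^ 2 = sinh (csqrt z) ^ 2"
    using sinhc_sqrt_power2 [of "csqrt z"] by (metis power2_csqrt power_mult_distrib)
  then show ?thesis by (simp add: cosh_sqrt_def cosh_square_eq)
qed

text \<open>
  The odd part of the exponential series, divided by \<open>w\<close>, is a power series in \<open>w\<^sup>2\<close>.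
\<close>

lemma sinhc_sqrt_sums: "(\<lambda>n. (1 / fact (2 * n + 1)) * z ^ n) sums sinhc_sqrt z"
proof (cases "z = 0")
  case True
  then show ?thesis using powser_sums_zero [of "\<lambda>n. 1 / fact (2 * n + 1) :: complex"] by simp
next
  case False
  define w where "w = csqrt z"
  have "w \<noteq> 0" "w\<^sup>2 = z" using False by (auto simp: w_def)
  have "(\<lambda>n. if even n then 0 else w ^ n /\<^sub>R fact n) sums sinh w" by (rule sinh_converges)
  moreover have "(if even n then 0 else w ^ n /\<^sub>R fact n) = 0" if "n \<notin> range (\<lambda>n. 2 * n + 1)" for n
  proof -
    have "even n"
    proof (rule ccontr)
      assume "odd n"
      then have "n = 2 * (n div 2) + 1" by simp
      with that show False by blast
    qed
    then show ?thesis by simp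
  qed
  moreover have "strict_mono (\<lambda>n::nat. 2 * n + 1)" by (simp add: strict_mono_def)
  ultimately have "(\<lambda>n. if even (2 * n + 1) then 0 else w ^ (2 * n + 1) /\<^sub>R fact (2 * n + 1)) sums sinh w"
    using sums_mono_reindex [of "\<lambda>n. 2 * n + 1" "\<lambda>n. if even n then 0 else w ^ n /\<^sub>R fact n" "sinh w"]
    by blast
  then have "(\<lambda>n. w ^ (2 * n + 1) /\<^sub>R fact (2 * n + 1)) sums sinh w" by simp
  from sums_divide [OF this, of w]
  have "(\<lambda>n. w ^ (2 * n + 1) /\<^sub>R fact (2 * n + 1) / w) sums (sinh w / w)" .
  moreover have "w ^ (2 * n + 1) /\<^sub>R fact (2 * n + 1) / w = (1 / fact (2 * n + 1)) * z ^ n" for n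
    using \<open>w \<noteq> 0\<close> by (simp add: scaleR_conv_of_real power_mult \<open>w\<^sup>2 = z\<close> divide_simps del: fact_Suc)
  ultimately show ?thesis using False by (simp add: sinhc_sqrt_def w_def)
qed

lemma sinhc_sqrt_holomorphic: "sinhc_sqrt holomorphic_on A"
proof -
  have "((\<lambda>z. \<Sum>n. (1 / fact (2 * n + 1)) * z ^ n) has_field_derivative
      (\<Sum>n. diffs (\<lambda>n. 1 / fact (2 * n + 1)) n * z ^ n)) (at z)" for z :: complex
    using sinhc_sqrt_sums by (intro termdiffs_strong_converges_everywhere) (auto simp: sums_iff)
  moreover have "(\<lambda>z. \<Sum>n. (1 / fact (2 * n + 1)) * z ^ n) = sinhc_sqrt"
    using sinhc_sqrt_sums by (auto simp: sums_iff fun_eq_iff)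
  ultimately have "(sinhc_sqrt has_field_derivative
      (\<Sum>n. diffs (\<lambda>n. 1 / fact (2 * n + 1)) n * z ^ n)) (at z)" for z by simp
  then have "sinhc_sqrt holomorphic_on UNIV"
    unfolding holomorphic_on_def field_differentiable_def by blast
  then show ?thesis by (rule holomorphic_on_subset) auto
qed

lemma sinhc_sqrt_holomorphic_compose [holomorphic_intros]:
  assumes "f holomorphic_on A"
  shows "(\<lambda>z. sinhc_sqrt (f z)) holomorphic_on A"
  using holomorphic_on_compose [OF assms sinhc_sqrt_holomorphic] by (simp add: o_def)

text \<open>
  This identity reduces holomorphy and the derivative at 0 of \<open>cosh_sqrt\<close>, whose definition goes
  through the discontinuous principal square root, to the power series of \<open>sinhc_sqrt\<close>.
\<close>

lemma cosh_sqrt_half_angle: "cosh_sqrt z = 1 + z / 2 * sinhc_sqrt (z / 4) ^ 2"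
proof -
  define w where "w = csqrt z / 2"
  have "w\<^sup>2 = z / 4" by (simp add: w_def power_divide)
  have "sinh w ^ 2 = z / 4 * sinhc_sqrt (z / 4) ^ 2"
    using sinhc_sqrt_power2 [of w] \<open>w\<^sup>2 = z / 4\<close> by (metis power_mult_distrib)
  moreover have "cosh_sqrt z = 1 + 2 * sinh w ^ 2"
    using cosh_double [of w] by (simp add: cosh_sqrt_def w_def cosh_square_eq)
  ultimately show ?thesis by (simp add: mult.commute)
qed

lemma cosh_sqrt_holomorphic_compose [holomorphic_intros]:
  assumes "f holomorphic_on A"
  shows "(\<lambda>z. cosh_sqrt (f z)) holomorphic_on A"
  unfolding cosh_sqrt_half_angle by (intro holomorphic_intros assms) auto

lemma cosh_sqrt_has_field_derivative_0: "(cosh_sqrt has_field_derivative 1 / 2) (at 0)"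
proof -
  obtain D where D: "(sinhc_sqrt has_field_derivative D) (at 0)"
    using sinhc_sqrt_holomorphic [of UNIV] by (auto simp: holomorphic_on_def field_differentiable_def)
  have "((\<lambda>z. 1 + z / 2 * sinhc_sqrt (z / 4) ^ 2) has_field_derivative 1 / 2) (at 0)"
    by (rule derivative_eq_intros DERIV_chain2 [of sinhc_sqrt D] refl | simp add: D)+
  then show ?thesis by (simp add: cosh_sqrt_half_angle [abs_def])
qed

text \<open>
  The derivative at 0 is \<open>1 / 2\<close>, so a local inverse exists, although \<open>cosh\<close> itself has a critical
  point at 0: the square root in the argument has unfolded it.
\<close>

lemma cosh_sqrt_local_inverse:
  "\<exists>g V. open V \<and> 1 \<in> V \<and> g holomorphic_on V \<and> g 1 = 0 \<and> (\<forall>w\<in>V. cosh_sqrt (g w) = w)"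
proof -
  have hol: "cosh_sqrt holomorphic_on UNIV"
    using cosh_sqrt_holomorphic_compose [of "\<lambda>z. z"] by (simp add: holomorphic_on_ident)
  have "deriv cosh_sqrt 0 \<noteq> 0"
    using DERIV_imp_deriv [OF cosh_sqrt_has_field_derivative_0] by auto
  then obtain r where r: "r > 0" "open (cosh_sqrt ` ball 0 r)" "inj_on cosh_sqrt (ball 0 r)"
    using has_complex_derivative_locally_invertible [OF hol, of 0] by auto
  have "cosh_sqrt holomorphic_on ball 0 r" using hol by (rule holomorphic_on_subset) auto
  from holomorphic_has_inverse [OF this open_ball r(3)]
  obtain g where g: "g holomorphic_on (cosh_sqrt ` ball 0 r)" "\<And>z. z \<in> ball 0 r \<Longrightarrow> g (cosh_sqrt z) = z"
    by metis
  have "1 \<in> cosh_sqrt ` ball 0 r" using \<open>r > 0\<close> by (intro image_eqI [of _ _ 0]) auto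
  moreover have "g 1 = 0" using g(2) [of 0] \<open>r > 0\<close> by simp
  moreover have "\<forall>w\<in>cosh_sqrt ` ball 0 r. cosh_sqrt (g w) = w" using g(2) by auto
  ultimately show ?thesis using r(2) g(1) by blast
qed

section \<open>Exponential of a 2 by 2 matrix\<close>

text \<open>
  A matrix \<open>N\<close> with scalar square spans, together with the identity, a commutative algebra in which all
  computations with the exponential take place.
\<close>

lemma mat_span_mult:
  assumes "N ** N = mat \<Delta>"
  shows "(mat a + mat b ** N) ** (mat c + mat d ** N)
       = mat (a * c + b * d * \<Delta>) + mat (a * d + b * c) ** (N :: complex^'n^'n)"
proof -
  have "(mat a + mat b ** N) ** (mat c + mat d ** N)
      = mat a ** mat c + mat a ** (mat d ** N) + ((mat b ** N) ** mat c + (mat b ** N) ** (mat d ** N))"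
    by (simp only: matrix_add_ldistrib matrix_add_rdistrib add_ac)
  also have "(mat b ** N) ** mat c = mat (b * c) ** N"
    unfolding mat_mult_commute [of c, symmetric]
    by (simp add: mat_mult_mat matrix_mul_assoc mult.commute)
  also have "(mat b ** N) ** (mat d ** N) = mat (b * d * \<Delta>)"
    by (simp add: mat_mult_mat_mult assms mat_mult_mat)
  finally show ?thesis
    by (simp add: matrix_mul_assoc mat_mult_mat)
       (simp add: vec_eq_iff mat_mult_component mat_nth distrib_right)
qed

text \<open>
  Powers of \<open>m + N\<close> stay in the span of the identity and \<open>N\<close>.  With \<open>\<delta>\<^sup>2 = \<Delta>\<close> the coefficients are the even
  and the odd part in \<open>\<delta>\<close> of \<open>(m + \<delta>) ^ k\<close>, the latter divided by \<open>\<delta>\<close>, so that their exponential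
  generating functions are the two functions in the statement, times \<open>exp m\<close>.
\<close>

lemma mat_exp_square_scalar:
  fixes N :: "complex^'n^'n"
  assumes N: "N ** N = mat \<Delta>"
  shows "mat_exp (mat m + N) = mat (exp m) ** (mat (cosh_sqrt \<Delta>) + mat (sinhc_sqrt \<Delta>) ** N)"
proof -
  define \<delta> where "\<delta> = csqrt \<Delta>"
  have \<delta>: "\<delta> * \<delta> = \<Delta>" by (simp add: \<delta>_def flip: power2_eq_square)
  \<comment> \<open>For \<open>\<delta> = 0\<close> the coefficient \<open>q\<close> is the limit of the difference quotient, the derivative of the power.\<close>
  define p where "p = (\<lambda>k. ((m + \<delta>) ^ k + (m - \<delta>) ^ k) / 2)"
  define q where "q = (\<lambda>k. if \<delta> = 0 then of_nat k * m ^ (k - 1)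
                          else ((m + \<delta>) ^ k - (m - \<delta>) ^ k) / (2 * \<delta>))"
  have p_Suc: "p (Suc k) = m * p k + q k * \<Delta>" for k
    by (cases "\<delta> = 0") (auto simp: p_def q_def field_simps simp flip: \<delta>)
  have q_Suc: "q (Suc k) = m * q k + p k" for k
  proof (cases "\<delta> = 0")
    case True
    then show ?thesis by (cases k) (simp_all add: p_def q_def algebra_simps)
  next
    case False
    then show ?thesis by (simp add: p_def q_def field_simps)
  qed
  have power: "((**) (mat m + N) ^^ k) (mat 1) = mat (p k) + mat (q k) ** N" for k
  proof (induction k)
    case 0
    have "mat 0 ** N = 0" by (simp add: vec_eq_iff mat_mult_component)
    then show ?case by (simp add: p_def q_def)
  next
    case (Suc k)
    have "((**) (mat m + N) ^^ Suc k) (mat 1) = (mat m + mat 1 ** N) ** (mat (p k) + mat (q k) ** N)"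
      by (simp add: Suc.IH)
    also have "\<dots> = mat (p (Suc k)) + mat (q (Suc k)) ** N"
      by (subst mat_span_mult [OF N]) (simp add: p_Suc q_Suc)
    finally show ?case .
  qed
  have exp_sums: "(\<lambda>k. x ^ k / fact k) sums exp x" for x :: complex
    using exp_converges [of x] by (simp add: scaleR_conv_of_real divide_inverse mult.commute)
  have p_sums: "(\<lambda>k. p k / fact k) sums (exp m * cosh_sqrt \<Delta>)"
  proof -
    have "(\<lambda>k. ((m + \<delta>) ^ k / fact k + (m - \<delta>) ^ k / fact k) / 2)
            sums ((exp (m + \<delta>) + exp (m - \<delta>)) / 2)"
      by (intro sums_divide sums_add exp_sums)
    moreover have "(exp (m + \<delta>) + exp (m - \<delta>)) / 2 = exp m * cosh_sqrt \<Delta>"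
      by (simp add: cosh_sqrt_def cosh_field_def exp_add exp_diff exp_minus field_simps flip: \<delta>_def)
    ultimately show ?thesis by (simp add: p_def add_divide_distrib mult.commute)
  qed
  have q_sums: "(\<lambda>k. q k / fact k) sums (exp m * sinhc_sqrt \<Delta>)"
  proof (cases "\<delta> = 0")
    case True
    then have "\<Delta> = 0" using \<delta> by simp
    have "q (Suc k) / fact (Suc k) = m ^ k / fact k" for k
      using True by (simp add: q_def del: of_nat_Suc)
    then have "(\<lambda>k. q (Suc k) / fact (Suc k)) sums exp m"
      using exp_sums [of m] by simp
    then show ?thesis
      using \<open>\<Delta> = 0\<close> True by (subst (asm) sums_Suc_iff) (simp add: q_def)
  next
    case False
    have "(\<lambda>k. ((m + \<delta>) ^ k / fact k - (m - \<delta>) ^ k / fact k) / (2 * \<delta>))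
            sums ((exp (m + \<delta>) - exp (m - \<delta>)) / (2 * \<delta>))"
      by (intro sums_divide sums_diff exp_sums)
    moreover have "(exp (m + \<delta>) - exp (m - \<delta>)) / (2 * \<delta>) = exp m * sinhc_sqrt \<Delta>"
    proof -
      have "\<Delta> \<noteq> 0" using False \<delta> by auto
      then have "sinhc_sqrt \<Delta> = (exp \<delta> - exp (- \<delta>)) / 2 / \<delta>"
        by (simp add: sinhc_sqrt_def sinh_field_def \<delta>_def)
      then show ?thesis by (simp add: right_diff_distrib flip: exp_add)
    qed
    ultimately show ?thesis using False by (simp add: q_def diff_divide_distrib mult.commute)
  qed
  have "(\<lambda>k. (1 / fact k) *\<^sub>R (((**) (mat m + N) ^^ k) (mat 1))) sums
      (mat (exp m) ** (mat (cosh_sqrt \<Delta>) + mat (sinhc_sqrt \<Delta>) ** N))"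
    unfolding sums_vec_iff
  proof (intro allI)
    fix i j
    have mat: "(mat c :: complex^'n^'n) $ i $ j = c * mat 1 $ i $ j" for c
      by (simp add: mat_def)
    have "(\<lambda>k. p k / fact k * mat 1 $ i $ j + q k / fact k * N $ i $ j) sums
        (exp m * cosh_sqrt \<Delta> * mat 1 $ i $ j + exp m * sinhc_sqrt \<Delta> * N $ i $ j)"
      by (intro sums_add sums_mult2 p_sums q_sums)
    moreover have "((1 / fact k) *\<^sub>R (((**) (mat m + N) ^^ k) (mat 1))) $ i $ j
        = p k / fact k * mat 1 $ i $ j + q k / fact k * N $ i $ j" for k
      by (simp add: power mat_mult_component mat [of "p k"] scaleR_conv_of_real [where 'a = complex]
          add_divide_distrib distrib_left)
    moreover have "(mat (exp m) ** (mat (cosh_sqrt \<Delta>) + mat (sinhc_sqrt \<Delta>) ** N)) $ i $ j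
        = exp m * cosh_sqrt \<Delta> * mat 1 $ i $ j + exp m * sinhc_sqrt \<Delta> * N $ i $ j"
      by (simp add: mat_mult_component mat [of "cosh_sqrt \<Delta>"] distrib_left)
    ultimately show "(\<lambda>k. ((1 / fact k) *\<^sub>R (((**) (mat m + N) ^^ k) (mat 1))) $ i $ j) sums
      ((mat (exp m) ** (mat (cosh_sqrt \<Delta>) + mat (sinhc_sqrt \<Delta>) ** N)) $ i $ j)"
      by (simp only:)
  qed
  then show ?thesis by (simp add: mat_exp_def sums_iff)
qed

lemma mat_exp_scaleR_square_scalar:
  fixes N :: "complex^'n^'n"
  assumes N: "N ** N = mat \<Delta>" and "\<delta>\<^sup>2 = \<Delta>"
  shows "mat_exp (t *\<^sub>R (mat m + N)) = mat (exp (of_real t * m)) **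
    (mat (cosh (of_real t * \<delta>)) +
     mat (if \<delta> = 0 then of_real t else sinh (of_real t * \<delta>) / \<delta>) ** N)"
proof -
  have "t *\<^sub>R (mat m + N) = mat (of_real t * m) + mat (of_real t) ** N"
    by (simp only: scaleR_matrix matrix_add_ldistrib mat_mult_mat)
  moreover have "(mat (of_real t) ** N) ** (mat (of_real t) ** N) = mat ((of_real t * \<delta>)\<^sup>2)"
    by (simp only: mat_mult_mat_mult N mat_mult_mat power_mult_distrib \<open>\<delta>\<^sup>2 = \<Delta>\<close>)
       (simp only: power2_eq_square)
  moreover have "sinhc_sqrt ((of_real t * \<delta>)\<^sup>2) * of_real t
      = (if \<delta> = 0 then of_real t else sinh (of_real t * \<delta>) / \<delta>)"
    using sinhc_sqrt_power2 [of "of_real t * \<delta>"]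
    by (cases "\<delta> = 0") (simp_all add: eq_divide_eq mult_ac)
  ultimately show ?thesis
    by (simp add: mat_exp_square_scalar cosh_sqrt_power2 matrix_mul_assoc mat_mult_mat)
qed

definition half_trace :: "complex^2^2 \<Rightarrow> complex" where
  "half_trace M = (M $ 1 $ 1 + M $ 2 $ 2) / 2"

definition traceless_part :: "complex^2^2 \<Rightarrow> complex^2^2" where
  "traceless_part M = M - mat (half_trace M)"

text \<open>
  A quarter of the discriminant of the characteristic polynomial: the eigenvalues are the half trace
  plus and minus a square root of this number.
\<close>

definition discriminant :: "complex^2^2 \<Rightarrow> complex" where
  "discriminant M = ((M $ 1 $ 1 - M $ 2 $ 2) / 2)\<^sup>2 + M $ 1 $ 2 * M $ 2 $ 1"

text \<open>
  This is the theorem of Cayley and Hamilton for a traceless matrix.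
\<close>

lemma traceless_part_square: "traceless_part M ** traceless_part M = mat (discriminant M)"
  by (simp add: matrix2_eq_iff matrix2_mult_nth mat_nth traceless_part_def half_trace_def
      discriminant_def power2_eq_square field_simps)

lemma mat_exp_2:
  "mat_exp M = mat (exp (half_trace M)) **
     (mat (cosh_sqrt (discriminant M)) + mat (sinhc_sqrt (discriminant M)) ** traceless_part M)"
  using mat_exp_square_scalar [OF traceless_part_square [of M], of "half_trace M"]
  by (simp add: traceless_part_def)

lemma mat_exp_2_nth:
  "mat_exp M $ i $ j = exp (half_trace M) *
     (cosh_sqrt (discriminant M) * mat 1 $ i $ j
      + sinhc_sqrt (discriminant M) * (M $ i $ j - half_trace M * mat 1 $ i $ j))"
  by (simp add: mat_exp_2 mat_mult_component traceless_part_def mat_nth)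

lemma mat_exp_add_scaleR:
  fixes M :: "complex^2^2"
  shows "mat_exp ((s + t) *\<^sub>R M) = mat_exp (s *\<^sub>R M) ** mat_exp (t *\<^sub>R M)"
proof -
  define \<delta> where "\<delta> = csqrt (discriminant M)"
  define m where "m = half_trace M"
  define N where "N = traceless_part M"
  define G where "G = (\<lambda>t::real. if \<delta> = 0 then of_real t else sinh (of_real t * \<delta>) / \<delta>)"
  have N: "N ** N = mat (\<delta>\<^sup>2)" by (simp add: N_def \<delta>_def traceless_part_square)
  have M: "M = mat m + N" by (simp add: m_def N_def traceless_part_def)
  have E: "mat_exp (t *\<^sub>R M) = mat (exp (of_real t * m)) ** (mat (cosh (of_real t * \<delta>)) + mat (G t) ** N)" for t
    unfolding M G_def by (rule mat_exp_scaleR_square_scalar [OF N refl])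
  have "cosh (of_real (s + t) * \<delta>) = cosh (of_real s * \<delta>) * cosh (of_real t * \<delta>) + G s * G t * \<delta>\<^sup>2"
    by (simp add: G_def algebra_simps cosh_add power2_eq_square)
  moreover have "G (s + t) = cosh (of_real s * \<delta>) * G t + G s * cosh (of_real t * \<delta>)"
    by (simp add: G_def algebra_simps sinh_add add_divide_distrib)
  ultimately show ?thesis
    by (simp add: E mat_mult_mat_mult mat_span_mult [OF N] exp_add [symmetric] ring_distribs)
qed

lemma mat_exp_0: "mat_exp (0 :: complex^2^2) = mat 1"
  by (simp add: matrix2_eq_iff mat_exp_2_nth half_trace_def discriminant_def mat_nth)

lemma mat_exp_minus_mult:
  fixes M :: "complex^2^2"
  shows "mat_exp (- t *\<^sub>R M) ** mat_exp (t *\<^sub>R M) = mat 1"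
  using mat_exp_add_scaleR [of "- t" t M] by (simp add: mat_exp_0)

lemma mat_exp_scalar_add:
  fixes M :: "complex^2^2"
  shows "mat_exp (mat c + M) = mat (exp c) ** mat_exp M"
proof -
  have "half_trace (mat c + M) = c + half_trace M" "discriminant (mat c + M) = discriminant M"
       "traceless_part (mat c + M) = traceless_part M"
    by (simp_all add: half_trace_def discriminant_def traceless_part_def matrix2_eq_iff mat_nth field_simps)
  then show ?thesis by (simp add: mat_exp_2 exp_add matrix_mul_assoc mat_mult_mat)
qed

lemma mat_exp_diagonal:
  fixes M :: "complex^2^2"
  assumes "M $ 1 $ 2 = 0" "M $ 2 $ 1 = 0"
  shows "mat_exp M = vector [vector [exp (M $ 1 $ 1), 0], vector [0, exp (M $ 2 $ 2)]]"
proof -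
  define h where "h = (M $ 1 $ 1 - M $ 2 $ 2) / 2"
  have d: "discriminant M = h\<^sup>2" using assms by (simp add: discriminant_def h_def)
  have 1: "M $ 1 $ 1 - half_trace M = h" "M $ 2 $ 2 - half_trace M = - h"
    "half_trace M + h = M $ 1 $ 1" "half_trace M - h = M $ 2 $ 2"
    by (simp_all add: half_trace_def h_def field_simps)
  have 2: "sinhc_sqrt (h\<^sup>2) * h = sinh h" using sinhc_sqrt_power2 [of h] by (simp add: mult.commute)
  have "exp (half_trace M) * (cosh h + sinh h) = exp (M $ 1 $ 1)"
    "exp (half_trace M) * (cosh h - sinh h) = exp (M $ 2 $ 2)"
    by (simp_all add: cosh_plus_sinh cosh_minus_sinh 1 flip: exp_add)
  then show ?thesis
    by (simp add: matrix2_eq_iff mat_exp_2_nth mat_nth d 1 2 assms cosh_sqrt_power2)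
qed

lemma mat_exp_has_vector_derivative:
  fixes M :: "complex^2^2"
  shows "((\<lambda>t. mat_exp (t *\<^sub>R M)) has_vector_derivative M ** mat_exp (t *\<^sub>R M)) (at t)"
proof -
  \<comment> \<open>Along the ray through \<open>M\<close> the exponential is \<open>E (C + G N)\<close> with \<open>C' = \<delta>\<^sup>2 G\<close>, \<open>G' = C\<close> and \<open>E' = m E\<close>, which
    matches multiplication by \<open>m + N\<close>.\<close>
  define \<delta> where "\<delta> = csqrt (discriminant M)"
  define m where "m = half_trace M"
  define N where "N = traceless_part M"
  define G where "G = (\<lambda>t::real. if \<delta> = 0 then of_real t else sinh (of_real t * \<delta>) / \<delta>)"
  define C where "C = (\<lambda>t::real. cosh (of_real t * \<delta>))"
  define E where "E = (\<lambda>t::real. exp (of_real t * m))"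
  have N: "N ** N = mat (\<delta>\<^sup>2)" by (simp add: N_def \<delta>_def traceless_part_square)
  have M: "M = mat m + mat 1 ** N" by (simp add: m_def N_def traceless_part_def)
  have mat_exp: "mat_exp (t *\<^sub>R M) = mat (E t) ** (mat (C t) + mat (G t) ** N)" for t
    using mat_exp_scaleR_square_scalar [OF N refl, of t m] by (simp add: M C_def G_def E_def)
  have C: "(C has_vector_derivative \<delta>\<^sup>2 * G t) (at t)"
  proof -
    have "((\<lambda>z. cosh (z * \<delta>)) has_field_derivative \<delta> * sinh (of_real t * \<delta>)) (at (of_real t))"
      by (rule derivative_eq_intros refl | simp)+
    from has_vector_derivative_real_field [OF this] show ?thesis
      by (auto simp: C_def G_def power2_eq_square)
  qed
  have G: "(G has_vector_derivative C t) (at t)"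
  proof -
    have "((\<lambda>z. if \<delta> = 0 then z else sinh (z * \<delta>) / \<delta>) has_field_derivative
        cosh (of_real t * \<delta>)) (at (of_real t))"
      by (cases "\<delta> = 0") (simp_all, (rule derivative_eq_intros refl | simp)+)
    from has_vector_derivative_real_field [OF this] show ?thesis
      by (simp add: C_def G_def)
  qed
  have E: "(E has_vector_derivative m * E t) (at t)"
  proof -
    have "((\<lambda>z. exp (z * m)) has_field_derivative m * exp (of_real t * m)) (at (of_real t))"
      by (rule derivative_eq_intros refl | simp)+
    from has_vector_derivative_real_field [OF this] show ?thesis by (simp add: E_def)
  qed
  have entry: "mat_exp (t *\<^sub>R M) $ i $ j = E t * (C t * mat 1 $ i $ j + G t * N $ i $ j)" for t i j
    by (simp add: mat_exp mat_mult_component mat_nth)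
  have "M ** mat_exp (t *\<^sub>R M) = mat (E t) ** (M ** (mat (C t) + mat (G t) ** N))"
    by (simp add: mat_exp mat_mult_left_commute)
  also have "M ** (mat (C t) + mat (G t) ** N)
      = mat (m * C t + G t * \<delta>\<^sup>2) + mat (m * G t + C t) ** N"
    unfolding M by (subst mat_span_mult [OF N]) simp
  finally have M_mult: "(M ** mat_exp (t *\<^sub>R M)) $ i $ j
      = E t * ((m * C t + G t * \<delta>\<^sup>2) * mat 1 $ i $ j + (m * G t + C t) * N $ i $ j)" for i j
    by (simp add: mat_mult_component mat_nth)
  show ?thesis
  proof (rule has_vector_derivative_vecI, rule has_vector_derivative_vecI)
    fix i j
    have "((\<lambda>t. E t * (C t * mat 1 $ i $ j + G t * N $ i $ j)) has_vector_derivative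
        E t * (\<delta>\<^sup>2 * G t * mat 1 $ i $ j + C t * N $ i $ j)
        + m * E t * (C t * mat 1 $ i $ j + G t * N $ i $ j)) (at t)"
      by (intro has_vector_derivative_mult has_vector_derivative_add E
          has_vector_derivative_mult_left C G)
    then show "((\<lambda>t. mat_exp (t *\<^sub>R M) $ i $ j) has_vector_derivative
        (M ** mat_exp (t *\<^sub>R M)) $ i $ j) (at t)"
      unfolding entry M_mult by (simp add: algebra_simps)
  qed
qed

lemma half_trace_holomorphic:
  assumes "\<And>i j. (\<lambda>\<epsilon>. M \<epsilon> $ i $ j) holomorphic_on A"
  shows "(\<lambda>\<epsilon>. half_trace (M \<epsilon>)) holomorphic_on A"
  unfolding half_trace_def by (intro holomorphic_intros assms) auto

lemma discriminant_holomorphic: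
  assumes "\<And>i j. (\<lambda>\<epsilon>. M \<epsilon> $ i $ j) holomorphic_on A"
  shows "(\<lambda>\<epsilon>. discriminant (M \<epsilon>)) holomorphic_on A"
  unfolding discriminant_def by (intro holomorphic_intros assms) auto

lemma mat_exp_holomorphic:
  fixes M :: "complex \<Rightarrow> complex^2^2"
  assumes "\<And>i j. (\<lambda>\<epsilon>. M \<epsilon> $ i $ j) holomorphic_on A"
  shows "(\<lambda>\<epsilon>. mat_exp (M \<epsilon>) $ i $ j) holomorphic_on A"
  unfolding mat_exp_2_nth
  by (intro holomorphic_intros half_trace_holomorphic discriminant_holomorphic assms)

text \<open>
  The discriminant vanishes to second order at the scalar matrices, so that near them only the half
  trace and the traceless part vary to first order, both with the factor \<open>exp m\<close>.
\<close>

lemma mat_exp_deriv_scalar: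
  fixes L :: "complex \<Rightarrow> complex^2^2"
  assumes L: "\<And>i j. ((\<lambda>\<epsilon>. L \<epsilon> $ i $ j) has_field_derivative L' $ i $ j) (at 0)" and "L 0 = mat m"
  shows "((\<lambda>\<epsilon>. mat_exp (L \<epsilon>) $ i $ j) has_field_derivative exp m * L' $ i $ j) (at 0)"
proof -
  obtain D where D: "(sinhc_sqrt has_field_derivative D) (at 0)"
    using sinhc_sqrt_holomorphic [of UNIV] by (auto simp: holomorphic_on_def field_differentiable_def)
  have 0: "half_trace (L 0) = m" "discriminant (L 0) = 0"
    by (simp_all add: \<open>L 0 = mat m\<close> half_trace_def discriminant_def mat_nth)
  have h: "((\<lambda>\<epsilon>. half_trace (L \<epsilon>)) has_field_derivative half_trace L') (at 0)"
    unfolding half_trace_def by (rule derivative_eq_intros L refl | simp)+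
  have d: "((\<lambda>\<epsilon>. discriminant (L \<epsilon>)) has_field_derivative 0) (at 0)"
    unfolding discriminant_def
    by (rule derivative_eq_intros L refl | simp add: \<open>L 0 = mat m\<close> mat_nth)+
  have c: "((\<lambda>\<epsilon>. cosh_sqrt (discriminant (L \<epsilon>))) has_field_derivative 0) (at 0)"
    using DERIV_chain2 [of cosh_sqrt "1/2" "\<lambda>\<epsilon>. discriminant (L \<epsilon>)", OF _ d] cosh_sqrt_has_field_derivative_0
    by (simp add: 0)
  have s: "((\<lambda>\<epsilon>. sinhc_sqrt (discriminant (L \<epsilon>))) has_field_derivative 0) (at 0)"
    using DERIV_chain2 [of sinhc_sqrt D "\<lambda>\<epsilon>. discriminant (L \<epsilon>)", OF _ d] D
    by (simp add: 0)
  have "((\<lambda>\<epsilon>. exp (half_trace (L \<epsilon>)) *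
      (cosh_sqrt (discriminant (L \<epsilon>)) * mat 1 $ i $ j
       + sinhc_sqrt (discriminant (L \<epsilon>)) * (L \<epsilon> $ i $ j - half_trace (L \<epsilon>) * mat 1 $ i $ j)))
     has_field_derivative
      exp m * half_trace L' * (mat 1 $ i $ j + (L 0 $ i $ j - m * mat 1 $ i $ j))
      + exp m * (L' $ i $ j - half_trace L' * mat 1 $ i $ j)) (at 0)"
    by (rule derivative_eq_intros h c s L refl | simp add: 0)+
  also have "exp m * half_trace L' * (mat 1 $ i $ j + (L 0 $ i $ j - m * mat 1 $ i $ j))
      + exp m * (L' $ i $ j - half_trace L' * mat 1 $ i $ j) = exp m * L' $ i $ j"
    by (simp add: \<open>L 0 = mat m\<close> mat_nth right_diff_distrib)
  finally show ?thesis unfolding mat_exp_2_nth .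
qed

section \<open>Holomorphic logarithm near the identity\<close>

lemma holomorphic_preimage_contains_ball:
  fixes f :: "complex \<Rightarrow> complex"
  assumes "f holomorphic_on ball 0 R" "R > 0" "open U" "f 0 \<in> U"
  shows "\<exists>r>0. r \<le> R \<and> (\<forall>z\<in>ball 0 r. f z \<in> U)"
proof -
  have "open (ball 0 R \<inter> f -` U)"
    using assms by (intro continuous_open_preimage holomorphic_on_imp_continuous_on) auto
  moreover have "0 \<in> ball 0 R \<inter> f -` U" using assms by simp
  ultimately obtain r where "r > 0" "ball 0 r \<subseteq> ball 0 R \<inter> f -` U"
    by (meson open_contains_ball)
  then show ?thesis
    by (intro exI [of _ "min r R"]) (use \<open>R > 0\<close> in auto)
qed

text \<open>
  Dividing \<open>M\<close> by a square root \<open>exp \<tau>\<close> of its determinant leaves a matrix \<open>h + N'\<close> of determinant 1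
  with \<open>N'\<close> traceless, so that \<open>N'\<^sup>2 = h\<^sup>2 - 1\<close>.  Choose \<open>\<Delta>\<close> holomorphically with \<open>cosh_sqrt \<Delta> = h\<close>.  Then
  \<open>h\<^sup>2 - 1 = \<Delta> (sinhc_sqrt \<Delta>)\<^sup>2\<close>, so \<open>N = N' / sinhc_sqrt \<Delta>\<close> has square \<open>\<Delta>\<close>, and the closed form of the exponential
  shows that \<open>\<tau> + N\<close> is a logarithm of \<open>M\<close>.
\<close>

lemma mat_log_holomorphic:
  fixes M :: "complex \<Rightarrow> complex^2^2"
  assumes M: "\<And>i j. (\<lambda>\<epsilon>. M \<epsilon> $ i $ j) holomorphic_on UNIV" and "M 0 = mat 1"
  obtains L r where "r > 0" "\<forall>i j. (\<lambda>\<epsilon>. L \<epsilon> $ i $ j) holomorphic_on ball 0 r"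
    "L 0 = 0" "\<forall>\<epsilon>\<in>ball 0 r. mat_exp (L \<epsilon>) = M \<epsilon>"
proof -
  obtain g V where g: "open V" "1 \<in> V" "g holomorphic_on V" "g 1 = 0"
    "\<And>w. w \<in> V \<Longrightarrow> cosh_sqrt (g w) = w"
    using cosh_sqrt_local_inverse by blast
  define dt where "dt = (\<lambda>\<epsilon>. M \<epsilon> $ 1 $ 1 * M \<epsilon> $ 2 $ 2 - M \<epsilon> $ 1 $ 2 * M \<epsilon> $ 2 $ 1)"
  define \<tau> where "\<tau> = (\<lambda>\<epsilon>. Ln (dt \<epsilon>) / 2)"
  define h where "h = (\<lambda>\<epsilon>. half_trace (M \<epsilon>) / exp (\<tau> \<epsilon>))"
  define S where "S = (\<lambda>\<epsilon>. sinhc_sqrt (g (h \<epsilon>)))"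
  define N where "N = (\<lambda>\<epsilon>. mat (1 / (exp (\<tau> \<epsilon>) * S \<epsilon>)) ** traceless_part (M \<epsilon>))"
  define L where "L = (\<lambda>\<epsilon>. mat (\<tau> \<epsilon>) + N \<epsilon>)"
  have at0: "dt 0 = 1" "\<tau> 0 = 0" "h 0 = 1" "S 0 = 1"
    by (simp_all add: dt_def \<tau>_def h_def S_def \<open>M 0 = mat 1\<close> mat_nth half_trace_def g)
  have dt_hol: "dt holomorphic_on A" for A
    unfolding dt_def by (intro holomorphic_intros holomorphic_on_subset [OF M]) auto
  \<comment> \<open>Three successive restrictions: the logarithm of the determinant is holomorphic, the local inverse
    \<open>g\<close> is applicable, and the denominator \<open>S\<close> does not vanish.\<close>
  have "\<exists>r>0. r \<le> 1 \<and> (\<forall>z\<in>ball 0 r. dt z \<in> - \<real>\<^sub>\<le>\<^sub>0)"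
    using at0 by (intro holomorphic_preimage_contains_ball dt_hol) auto
  then obtain r1 where r1: "r1 > 0" "\<And>\<epsilon>. \<epsilon> \<in> ball 0 r1 \<Longrightarrow> dt \<epsilon> \<notin> \<real>\<^sub>\<le>\<^sub>0" by auto
  have \<tau>_hol: "\<tau> holomorphic_on ball 0 r1"
    unfolding \<tau>_def by (intro holomorphic_intros dt_hol) (use r1 in auto)
  have h_hol: "h holomorphic_on ball 0 r1"
    unfolding h_def
    by (intro holomorphic_intros half_trace_holomorphic \<tau>_hol holomorphic_on_subset [OF M]) auto
  have "\<exists>r>0. r \<le> r1 \<and> (\<forall>z\<in>ball 0 r. h z \<in> V)"
    using at0 g r1 by (intro holomorphic_preimage_contains_ball h_hol) auto
  then obtain r3 where r3: "r3 > 0" "r3 \<le> r1" "\<And>\<epsilon>. \<epsilon> \<in> ball 0 r3 \<Longrightarrow> h \<epsilon> \<in> V" by auto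
  have gh_hol: "(\<lambda>\<epsilon>. g (h \<epsilon>)) holomorphic_on ball 0 r3"
  proof -
    have "ball 0 r3 \<subseteq> ball 0 r1" using r3(2) by (rule subset_ball)
    with h_hol have "h holomorphic_on ball 0 r3" by (rule holomorphic_on_subset)
    from holomorphic_on_compose_gen [OF this g(3)] show ?thesis
      using r3(3) by (simp add: o_def image_subset_iff)
  qed
  have S_hol: "S holomorphic_on ball 0 r3"
    unfolding S_def by (intro holomorphic_intros gh_hol)
  have "\<exists>r>0. r \<le> r3 \<and> (\<forall>z\<in>ball 0 r. S z \<in> - {0})"
    using at0 r3 by (intro holomorphic_preimage_contains_ball S_hol) auto
  then obtain r where r: "r > 0" "r \<le> r3" "\<And>\<epsilon>. \<epsilon> \<in> ball 0 r \<Longrightarrow> S \<epsilon> \<noteq> 0" by auto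
  show ?thesis
  proof (rule that [of r L])
    show "r > 0" by (rule r)
    show "L 0 = 0"
      by (simp add: L_def N_def at0 \<open>M 0 = mat 1\<close> traceless_part_def half_trace_def
          matrix2_eq_iff mat_nth mat_mult_component)
    show "\<forall>i j. (\<lambda>\<epsilon>. L \<epsilon> $ i $ j) holomorphic_on ball 0 r"
    proof (intro allI)
      fix i j
      have \<tau>: "\<tau> holomorphic_on ball 0 r" using \<tau>_hol by (rule holomorphic_on_subset) (use r r3 in auto)
      have S: "S holomorphic_on ball 0 r" using S_hol by (rule holomorphic_on_subset) (use r in auto)
      have M': "(\<lambda>\<epsilon>. M \<epsilon> $ i $ j) holomorphic_on ball 0 r" for i j
        using M by (rule holomorphic_on_subset) auto
      have t: "(\<lambda>\<epsilon>. traceless_part (M \<epsilon>) $ i $ j) holomorphic_on ball 0 r" for i j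
        unfolding traceless_part_def mat_nth vector_minus_component
        by (cases "i = j") (simp_all, (intro holomorphic_intros half_trace_holomorphic M')+)
      have n: "(\<lambda>\<epsilon>. N \<epsilon> $ i $ j) holomorphic_on ball 0 r" for i j
        unfolding N_def mat_mult_component
        by (intro holomorphic_intros \<tau> S t) (use r in auto)
      show "(\<lambda>\<epsilon>. L \<epsilon> $ i $ j) holomorphic_on ball 0 r"
        unfolding L_def mat_nth vector_add_component
        by (cases "i = j") (simp_all, (intro holomorphic_intros \<tau> n)+)
    qed
    show "\<forall>\<epsilon>\<in>ball 0 r. mat_exp (L \<epsilon>) = M \<epsilon>"
    proof
      fix \<epsilon> :: complex assume \<epsilon>: "\<epsilon> \<in> ball 0 r"
      have nz: "dt \<epsilon> \<noteq> 0" "S \<epsilon> \<noteq> 0" and V: "h \<epsilon> \<in> V"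
        using \<epsilon> r1(2) [of \<epsilon>] r3(2,3) r(2,3) by auto
      have e2: "exp (\<tau> \<epsilon>) ^ 2 = dt \<epsilon>" using nz by (simp add: \<tau>_def flip: exp_double)
      have C: "cosh_sqrt (g (h \<epsilon>)) = h \<epsilon>" using g(5) [OF V] .
      have "h \<epsilon> ^ 2 - 1 = g (h \<epsilon>) * S \<epsilon> ^ 2"
        using cosh_sqrt_square [of "g (h \<epsilon>)"] by (simp add: C S_def algebra_simps)
      moreover have "discriminant (M \<epsilon>) = exp (\<tau> \<epsilon>) ^ 2 * (h \<epsilon> ^ 2 - 1)"
      proof -
        have "exp (\<tau> \<epsilon>) ^ 2 * (h \<epsilon> ^ 2 - 1) = half_trace (M \<epsilon>) ^ 2 - dt \<epsilon>"
          by (simp add: h_def power_divide right_diff_distrib flip: e2)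
        also have "\<dots> = discriminant (M \<epsilon>)"
          by (simp add: dt_def discriminant_def half_trace_def power2_eq_square field_simps)
        finally show ?thesis by simp
      qed
      ultimately have disc: "discriminant (M \<epsilon>) = (exp (\<tau> \<epsilon>) * S \<epsilon>) ^ 2 * g (h \<epsilon>)"
        by (simp add: power_mult_distrib)
      have "N \<epsilon> ** N \<epsilon> = mat ((1 / (exp (\<tau> \<epsilon>) * S \<epsilon>)) ^ 2) ** mat (discriminant (M \<epsilon>))"
        unfolding N_def
        by (simp add: mat_mult_mat_mult power2_eq_square flip: traceless_part_square)
      also have "\<dots> = mat (g (h \<epsilon>))"
        using nz by (simp add: disc mat_mult_mat power_divide)
      finally have "mat_exp (L \<epsilon>) = mat (exp (\<tau> \<epsilon>)) ** (mat (h \<epsilon>) + mat (S \<epsilon>) ** N \<epsilon>)"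
        unfolding L_def using mat_exp_square_scalar [of "N \<epsilon>" "g (h \<epsilon>)"] by (simp add: C S_def)
      also have "mat (S \<epsilon>) ** N \<epsilon> = mat (1 / exp (\<tau> \<epsilon>)) ** traceless_part (M \<epsilon>)"
        using nz by (simp add: N_def matrix_mul_assoc mat_mult_mat)
      also have "mat (exp (\<tau> \<epsilon>)) ** (mat (h \<epsilon>) + \<dots>) = M \<epsilon>"
        by (simp add: matrix_add_ldistrib matrix_mul_assoc mat_mult_mat h_def traceless_part_def)
      finally show "mat_exp (L \<epsilon>) = M \<epsilon>" .
    qed
  qed
qed

section \<open>Diagonalizability\<close>

lemma invertible_matrix_inv:
  assumes "invertible (S :: complex^'n^'n)"
  shows "S ** matrix_inv S = mat 1" "matrix_inv S ** S = mat 1"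
  using someI_ex [OF assms [unfolded invertible_def]] unfolding matrix_inv_def by auto

lemma diagonalizableI:
  fixes M S D :: "complex^'n^'n"
  assumes "det S \<noteq> 0" "diagonal D" "M ** S = S ** D"
  shows "diagonalizable M"
proof -
  have S: "invertible S" using assms(1) invertible_det_nz by blast
  have "M = (M ** S) ** matrix_inv S"
    using invertible_matrix_inv(1) [OF S] by (simp flip: matrix_mul_assoc)
  then have "M = S ** D ** matrix_inv S" unfolding assms(3) .
  with S assms(2) show ?thesis unfolding diagonalizable_def by blast
qed

text \<open>
  The two eigenvalues \<open>\<mu> + \<delta>\<close> and \<open>\<mu> - \<delta>\<close> are distinct, so a matrix of eigenvectors is invertible.  The
  eigenvector can be read off the first row if the entry \<open>b\<close> is nonzero, and off the second row if \<open>c\<close>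
  is nonzero.
\<close>

lemma diagonalizable_if_discriminant_nonzero:
  assumes "discriminant M \<noteq> 0"
  shows "diagonalizable M"
proof -
  define \<delta> where "\<delta> = csqrt (discriminant M)"
  define \<mu> where "\<mu> = half_trace M"
  define a where "a = M $ 1 $ 1"
  define b where "b = M $ 1 $ 2"
  define c where "c = M $ 2 $ 1"
  define d where "d = M $ 2 $ 2"
  have "\<delta> \<noteq> 0" using assms by (simp add: \<delta>_def)
  have \<delta>: "\<delta> * \<delta> = ((a - d) / 2) * ((a - d) / 2) + b * c"
    using power2_csqrt [of "discriminant M"]
    by (simp add: \<delta>_def discriminant_def a_def b_def c_def d_def power2_eq_square)
  have \<mu>: "\<mu> = (a + d) / 2" by (simp add: \<mu>_def half_trace_def a_def d_def)
  have eig: "(\<mu> + \<delta>) * (\<mu> + \<delta>) - (a + d) * (\<mu> + \<delta>) + a * d - b * c = 0"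
    "(\<mu> - \<delta>) * (\<mu> - \<delta>) - (a + d) * (\<mu> - \<delta>) + a * d - b * c = 0"
  proof -
    have "(\<mu> + e) * (\<mu> + e) - (a + d) * (\<mu> + e) + a * d - b * c
        = e * e - (((a - d) / 2) * ((a - d) / 2) + b * c)" for e
      by (simp add: \<mu> field_simps)
    from this [of \<delta>] this [of "- \<delta>"]
    show "(\<mu> + \<delta>) * (\<mu> + \<delta>) - (a + d) * (\<mu> + \<delta>) + a * d - b * c = 0"
      "(\<mu> - \<delta>) * (\<mu> - \<delta>) - (a + d) * (\<mu> - \<delta>) + a * d - b * c = 0"
      using \<delta> by simp_all
  qed
  define D :: "complex^2^2" where "D = vector [vector [\<mu> + \<delta>, 0], vector [0, \<mu> - \<delta>]]"
  have D: "diagonal D" by (simp add: diagonal_def D_def forall_2)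
  consider "b \<noteq> 0" | "c \<noteq> 0" | "b = 0" "c = 0" by blast
  then show ?thesis
  proof cases
    case 1
    define S :: "complex^2^2" where
      "S = vector [vector [b, b], vector [\<mu> + \<delta> - a, \<mu> - \<delta> - a]]"
    show ?thesis
    proof (rule diagonalizableI [OF _ D])
      have "det S = - 2 * b * \<delta>" by (simp add: det_2 S_def algebra_simps)
      then show "det S \<noteq> 0" using 1 \<open>\<delta> \<noteq> 0\<close> by simp
      show "M ** S = S ** D"
        using eig by (simp add: matrix2_eq_iff matrix2_mult_nth S_def D_def algebra_simps
            flip: a_def b_def c_def d_def)
    qed
  next
    case 2
    define S :: "complex^2^2" where
      "S = vector [vector [\<mu> + \<delta> - d, \<mu> - \<delta> - d], vector [c, c]]"
    show ?thesis
    proof (rule diagonalizableI [OF _ D])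
      have "det S = 2 * c * \<delta>" by (simp add: det_2 S_def algebra_simps)
      then show "det S \<noteq> 0" using 2 \<open>\<delta> \<noteq> 0\<close> by simp
      show "M ** S = S ** D"
        using eig by (simp add: matrix2_eq_iff matrix2_mult_nth S_def D_def algebra_simps
            flip: a_def b_def c_def d_def)
    qed
  next
    case 3
    show ?thesis
    proof (rule diagonalizableI [of "mat 1" M])
      show "diagonal M" using 3 by (simp add: diagonal_def forall_2 b_def c_def)
    qed simp_all
  qed
qed

text \<open>
  Diagonalizing the sum would diagonalize \<open>N\<close>, but a diagonal matrix with square zero is zero.
\<close>

lemma not_diagonalizable_scalar_plus_nilpotent:
  fixes N :: "complex^'n^'n"
  assumes "N ** N = 0" "N \<noteq> 0"
  shows "\<not> diagonalizable (mat \<sigma> + N)"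
proof
  assume "diagonalizable (mat \<sigma> + N)"
  then obtain S D :: "complex^'n^'n"
    where S: "invertible S" and D: "diagonal D" and eq: "mat \<sigma> + N = S ** D ** matrix_inv S"
    unfolding diagonalizable_def by blast
  define R where "R = matrix_inv S"
  have SR: "S ** R = mat 1" "R ** S = mat 1"
    using invertible_matrix_inv [OF S] by (simp_all add: R_def)
  define D' where "D' = R ** N ** S"
  have "R ** (mat \<sigma> + N) ** S = (R ** S) ** D ** (R ** S)"
    unfolding eq R_def [symmetric] by (simp only: matrix_mul_assoc)
  then have "D = R ** (mat \<sigma> + N) ** S" by (simp add: SR)
  also have "\<dots> = mat \<sigma> ** (R ** S) + D'"
    by (simp add: D'_def matrix_add_ldistrib matrix_add_rdistrib matrix_mul_assoc flip: mat_mult_commute [of \<sigma> R])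
  finally have D': "D' = D - mat \<sigma>" by (simp add: SR)
  have "D' ** D' = R ** N ** (S ** R) ** N ** S"
    by (simp only: D'_def matrix_mul_assoc)
  also have "\<dots> = R ** (N ** N) ** S" by (simp add: SR matrix_mul_assoc)
  also have "\<dots> = 0"
    unfolding assms(1) by (simp add: vec_eq_iff matrix_matrix_mult_def)
  finally have DD: "D' ** D' = 0" .
  have off: "D' $ i $ j = 0" if "i \<noteq> j" for i j
    using D that by (simp add: D' diagonal_def mat_nth)
  have "D' $ i $ i = 0" for i
  proof -
    have "(D' ** D') $ i $ i = (\<Sum>k\<in>UNIV. if k = i then D' $ i $ i * D' $ i $ i else 0)"
      unfolding matrix_matrix_mult_def vec_lambda_beta by (intro sum.cong) (auto simp: off)
    then show ?thesis by (simp add: DD)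
  qed
  with off have "D' = 0" by (metis vec_eq_iff zero_index)
  moreover have "N = S ** D' ** R"
  proof -
    have "S ** D' ** R = (S ** R) ** N ** (S ** R)"
      by (simp only: D'_def matrix_mul_assoc)
    then show ?thesis by (simp add: SR)
  qed
  ultimately have "N = 0" by (simp add: vec_eq_iff matrix_matrix_mult_def)
  with assms show False by simp
qed

text \<open>
  The discriminant depends continuously on the perturbation and is nonzero at \<open>F0\<close>.
\<close>

lemma diagonalizable_perturbed_distinct:
  fixes F0 F1 :: "complex^2^2"
  assumes "diagonal F0" "F0 $ 1 $ 1 \<noteq> F0 $ 2 $ 2"
  shows "\<exists>\<epsilon>>0. diagonalizable (F0 + \<epsilon> *\<^sub>R F1)"
proof -
  define f where "f = (\<lambda>\<epsilon>::real. discriminant (F0 + \<epsilon> *\<^sub>R F1))"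
  have "continuous_on UNIV f"
    unfolding f_def discriminant_def by (simp, intro continuous_intros) auto
  then have "(f \<longlongrightarrow> f 0) (at 0 within {0<..})"
    by (meson UNIV_I continuous_on_def tendsto_within_subset top_greatest)
  moreover have "f 0 \<noteq> 0"
    using assms by (simp add: f_def discriminant_def diagonal_def)
  ultimately have "\<forall>\<^sub>F \<epsilon> in at_right 0. f \<epsilon> \<noteq> 0"
    by (rule tendsto_imp_eventually_ne)
  moreover have "\<forall>\<^sub>F \<epsilon> in at_right (0::real). \<epsilon> > 0"
    by (rule eventually_at_right_less)
  ultimately have "\<forall>\<^sub>F \<epsilon> in at_right 0. f \<epsilon> \<noteq> 0 \<and> \<epsilon> > 0"
    by (rule eventually_conj)
  then have "\<exists>\<epsilon>. f \<epsilon> \<noteq> 0 \<and> \<epsilon> > 0"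
    using eventually_happens' trivial_limit_at_right_real by blast
  then show ?thesis using diagonalizable_if_discriminant_nonzero by (auto simp: f_def)
qed

text \<open>
  The discriminant is \<open>\<epsilon>\<^sup>2 p q\<close>.  If it vanishes, the off-diagonal part is nilpotent, and the matrix is
  diagonalizable only if that part is zero.
\<close>

lemma not_diagonalizable_off_diagonal_iff:
  fixes p q \<sigma> :: complex
  shows "(\<forall>\<epsilon>::real. \<epsilon> > 0 \<longrightarrow>
      \<not> diagonalizable (mat \<sigma> + \<epsilon> *\<^sub>R vector [vector [0, p], vector [q, 0]] :: complex^2^2))
    \<longleftrightarrow> p * q = 0 \<and> (p \<noteq> 0 \<or> q \<noteq> 0)"
proof
  define N :: "complex^2^2" where "N = vector [vector [0, p], vector [q, 0]]"
  assume nd: "\<forall>\<epsilon>::real. \<epsilon> > 0 \<longrightarrow>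
      \<not> diagonalizable (mat \<sigma> + \<epsilon> *\<^sub>R vector [vector [0, p], vector [q, 0]] :: complex^2^2)"
  then have nd1: "\<not> diagonalizable (mat \<sigma> + N)" by (auto simp: N_def dest: spec [of _ 1])
  have "discriminant (mat \<sigma> + N) = p * q" by (simp add: discriminant_def N_def mat_nth)
  then have "p * q = 0" using nd1 diagonalizable_if_discriminant_nonzero by metis
  moreover have "p \<noteq> 0 \<or> q \<noteq> 0"
  proof (rule ccontr)
    assume "\<not> (p \<noteq> 0 \<or> q \<noteq> 0)"
    then have "mat \<sigma> + N = mat \<sigma>" by (simp add: N_def matrix2_eq_iff)
    moreover have "diagonalizable (mat \<sigma> :: complex^2^2)"
      by (rule diagonalizableI [of "mat 1" "mat \<sigma>"]) (simp_all add: diagonal_def mat_nth)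
    ultimately show False using nd1 by simp
  qed
  ultimately show "p * q = 0 \<and> (p \<noteq> 0 \<or> q \<noteq> 0)" ..
next
  assume pq: "p * q = 0 \<and> (p \<noteq> 0 \<or> q \<noteq> 0)"
  show "\<forall>\<epsilon>::real. \<epsilon> > 0 \<longrightarrow>
      \<not> diagonalizable (mat \<sigma> + \<epsilon> *\<^sub>R vector [vector [0, p], vector [q, 0]] :: complex^2^2)"
  proof (intro allI impI not_diagonalizable_scalar_plus_nilpotent)
    fix \<epsilon> :: real assume "\<epsilon> > 0"
    define N :: "complex^2^2" where "N = \<epsilon> *\<^sub>R vector [vector [0, p], vector [q, 0]]"
    have N: "N $ 1 $ 1 = 0" "N $ 1 $ 2 = \<epsilon> * p" "N $ 2 $ 1 = \<epsilon> * q" "N $ 2 $ 2 = 0"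
      by (simp_all add: N_def scaleR_conv_of_real [where 'a = complex])
    show "N ** N = 0" using pq by (auto simp: matrix2_eq_iff matrix2_mult_nth N)
    show "N \<noteq> 0" using pq \<open>\<epsilon> > 0\<close> by (auto simp: matrix2_eq_iff N)
  qed
qed

section \<open>Floquet decomposition at a scalar folded exponent\<close>

text \<open>
  Resonance means that the unperturbed monodromy \<open>exp (T A\<^sub>0)\<close> is the scalar \<open>exp (T \<sigma>)\<close>, so that
  \<open>F\<^sub>0 = \<sigma>\<close> is a folded exponent.  The substitution \<open>X = exp (t A\<^sub>0) Y\<close> leads to \<open>Y' = \<epsilon> B Y\<close>, and the
  perturbed monodromy is \<open>exp (T \<sigma>) Y(T)\<close>.

  Existence: a holomorphic logarithm \<open>L\<close> of \<open>Y(T)\<close> gives \<open>F = \<sigma> + L / T\<close>.  The factor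
  \<open>P(t) = X(t) exp (- t F)\<close> is periodic because \<open>X(t + T) = X(t) X(T)\<close>.

  First order coefficient: in any decomposition \<open>exp (T F) = exp (T \<sigma>) Y(T)\<close> by uniqueness of
  solutions.  Differentiating at \<open>\<epsilon> = 0\<close>, where \<open>F\<close> is scalar, yields that \<open>T F\<^sub>1\<close> is the integral of
  \<open>B\<close> over a period, expressed here through an arbitrary primitive \<open>G\<close> of \<open>B\<close>.
\<close>

lemma floquet_resonant:
  fixes A0 :: "complex^2^2" and A1 :: "real \<Rightarrow> complex^2^2"
  assumes "T > 0" and resonant: "mat_exp (T *\<^sub>R A0) = mat (exp (of_real T * \<sigma>))"
    and cont: "continuous_on UNIV A1" and periodic: "\<And>t. A1 (t + T) = A1 t"
  shows floquet_decomposition_exists: "\<exists>P F. floquet_decomposition A0 A1 T (mat \<sigma>) P F"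
    and first_order_coeff_eq_average:
      "\<And>P F G. floquet_decomposition A0 A1 T (mat \<sigma>) P F \<Longrightarrow>
        (\<And>t. (G has_vector_derivative mat_exp (- t *\<^sub>R A0) ** A1 t ** mat_exp (t *\<^sub>R A0)) (at t)) \<Longrightarrow>
        T *\<^sub>R first_order_coeff F = G T - G 0"
proof -
  define E where "E = (\<lambda>t. mat_exp (t *\<^sub>R A0))"
  define E' where "E' = (\<lambda>t. mat_exp (- t *\<^sub>R A0))"
  define B where "B = (\<lambda>t. E' t ** A1 t ** E t)"
  have E_deriv: "(E has_vector_derivative A0 ** E t) (at t)" for t
    unfolding E_def by (rule mat_exp_has_vector_derivative)
  have E_cont: "continuous_on UNIV E"
    using E_deriv by (intro continuous_at_imp_continuous_on ballI has_vector_derivative_continuous)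
  moreover have "E' = (\<lambda>t. E (- t))" by (simp add: E_def E'_def)
  ultimately have E'_cont: "continuous_on UNIV E'"
    by (auto intro!: continuous_on_compose2 [of UNIV E] continuous_intros)
  have EE': "E t ** E' t = mat 1" for t
    using mat_exp_minus_mult [of "- t" A0] by (simp add: E_def E'_def)
  have E0: "E 0 = mat 1" by (simp add: E_def mat_exp_0)
  have "continuous_on UNIV B"
    unfolding B_def
    by (intro bounded_bilinear.continuous_on [OF bounded_bilinear_matrix_matrix_mult] cont E_cont E'_cont)
  then obtain Y Y1 where
    Y_sol: "\<forall>\<epsilon>. fundamental_solution (\<lambda>t. mat \<epsilon> ** B t) (Y \<epsilon>)" and
    Y_0: "\<forall>t. Y 0 t = mat 1" and
    Y_hol: "\<forall>t i j. (\<lambda>\<epsilon>. Y \<epsilon> t $ i $ j) holomorphic_on UNIV" and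
    Y_deriv: "\<forall>t i j. ((\<lambda>\<epsilon>. Y \<epsilon> t $ i $ j) has_field_derivative (Y1 t $ i $ j)) (at 0)" and
    Y1: "Y1 0 = 0" "\<forall>t. (Y1 has_vector_derivative B t) (at t)"
    by (rule linear_ode_parameter_series)
  define A where "A = (\<lambda>\<epsilon> t. A0 + mat \<epsilon> ** A1 t)"
  define X where "X = (\<lambda>\<epsilon> t. E t ** Y \<epsilon> t)"
  have A_cont: "continuous_on UNIV (A \<epsilon>)" for \<epsilon>
    unfolding A_def
    by (intro continuous_intros bounded_bilinear.continuous_on [OF bounded_bilinear_matrix_matrix_mult] cont)
  have X_sol: "fundamental_solution (A \<epsilon>) (X \<epsilon>)" for \<epsilon>
    unfolding fundamental_solution_def
  proof (intro conjI allI)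
    show "X \<epsilon> 0 = mat 1" using Y_sol by (simp add: X_def E0 fundamental_solution_def)
    fix t
    have Y: "(Y \<epsilon> has_vector_derivative mat \<epsilon> ** B t ** Y \<epsilon> t) (at t)"
      using Y_sol by (simp add: fundamental_solution_def)
    have "(X \<epsilon> has_vector_derivative E t ** (mat \<epsilon> ** B t ** Y \<epsilon> t) + A0 ** E t ** Y \<epsilon> t) (at t)"
      unfolding X_def by (rule has_vector_derivative_matrix_mult [OF E_deriv Y])
    also have "E t ** (mat \<epsilon> ** B t ** Y \<epsilon> t) = mat \<epsilon> ** ((E t ** E' t) ** A1 t ** (E t ** Y \<epsilon> t))"
      by (simp add: B_def mat_mult_left_commute flip: matrix_mul_assoc)
    also have "\<dots> = mat \<epsilon> ** A1 t ** X \<epsilon> t" by (simp add: EE' X_def matrix_mul_assoc)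
    finally show "(X \<epsilon> has_vector_derivative A \<epsilon> t ** X \<epsilon> t) (at t)"
      by (simp add: A_def X_def matrix_add_rdistrib matrix_mul_assoc add.commute)
  qed
  have X_unique: "Z t = X \<epsilon> t" if "fundamental_solution (A \<epsilon>) Z" for \<epsilon> Z t
    by (rule linear_ode_unique [OF A_cont [of \<epsilon>]])
       (use that X_sol [of \<epsilon>] in \<open>simp_all add: fundamental_solution_def\<close>)
  have X_T: "X \<epsilon> T = mat (exp (of_real T * \<sigma>)) ** Y \<epsilon> T" for \<epsilon>
    by (simp add: X_def E_def resonant)
  have X_shift: "X \<epsilon> (t + T) = X \<epsilon> t ** X \<epsilon> T" for \<epsilon> t
  proof (rule linear_ode_unique [OF A_cont [of \<epsilon>], where U = "\<lambda>t. X \<epsilon> (t + T)"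
        and V = "\<lambda>t. X \<epsilon> t ** X \<epsilon> T"])
    fix s
    have X: "(X \<epsilon> has_vector_derivative A \<epsilon> t ** X \<epsilon> t) (at t)" for t
      using X_sol by (simp add: fundamental_solution_def)
    have "((X \<epsilon> \<circ> (\<lambda>s. s + T)) has_vector_derivative 1 *\<^sub>R (A \<epsilon> (s + T) ** X \<epsilon> (s + T))) (at s)"
      by (intro vector_diff_chain_at X) (auto intro!: derivative_eq_intros)
    then show "((\<lambda>s. X \<epsilon> (s + T)) has_vector_derivative A \<epsilon> s ** X \<epsilon> (s + T)) (at s)"
      by (simp add: o_def A_def periodic)
    have "((\<lambda>s. X \<epsilon> s ** X \<epsilon> T) has_vector_derivative X \<epsilon> s ** 0 + (A \<epsilon> s ** X \<epsilon> s) ** X \<epsilon> T) (at s)"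
      by (intro has_vector_derivative_matrix_mult X has_vector_derivative_const)
    then show "((\<lambda>s. X \<epsilon> s ** X \<epsilon> T) has_vector_derivative A \<epsilon> s ** (X \<epsilon> s ** X \<epsilon> T)) (at s)"
      by (simp add: matrix_mul_assoc bounded_bilinear.zero_right [OF bounded_bilinear_matrix_matrix_mult])
    show "X \<epsilon> (0 + T) = X \<epsilon> 0 ** X \<epsilon> T"
      using X_sol [of \<epsilon>] by (simp add: fundamental_solution_def)
  qed
  show "\<exists>P F. floquet_decomposition A0 A1 T (mat \<sigma>) P F"
  proof -
    obtain L r where "r > 0" and L_hol: "\<forall>i j. (\<lambda>\<epsilon>. L \<epsilon> $ i $ j) holomorphic_on ball 0 r"
      and "L 0 = 0" and L: "\<forall>\<epsilon>\<in>ball 0 r. mat_exp (L \<epsilon>) = Y \<epsilon> T"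
      by (rule mat_log_holomorphic [of "\<lambda>\<epsilon>. Y \<epsilon> T",
            OF Y_hol [rule_format] Y_0 [rule_format]])
    define F where "F = (\<lambda>\<epsilon>. mat \<sigma> + (1 / T) *\<^sub>R L \<epsilon>)"
    define P where "P = (\<lambda>\<epsilon> t. X \<epsilon> t ** mat_exp (- t *\<^sub>R F \<epsilon>))"
    have TF: "T *\<^sub>R F \<epsilon> = mat (of_real T * \<sigma>) + L \<epsilon>" for \<epsilon>
      using \<open>T > 0\<close> by (simp add: F_def scaleR_right_distrib) (simp add: scaleR_matrix mat_mult_mat)
    have F_T: "mat_exp (T *\<^sub>R F \<epsilon>) = X \<epsilon> T" if "\<epsilon> \<in> ball 0 r" for \<epsilon>
      by (simp add: TF mat_exp_scalar_add bspec [OF L that] X_T)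
    have F0: "F 0 = mat \<sigma>" by (simp add: F_def \<open>L 0 = 0\<close>)
    have F_hol: "(\<lambda>\<epsilon>. F \<epsilon> $ i $ j) holomorphic_on ball 0 r" for i j
      unfolding F_def by (simp add: scaleR_conv_of_real [where 'a = complex])
        (intro holomorphic_intros L_hol [rule_format], use \<open>T > 0\<close> in simp)
    have PX: "P \<epsilon> t ** mat_exp (t *\<^sub>R F \<epsilon>) = X \<epsilon> t" for \<epsilon> t
      by (simp add: P_def mat_exp_minus_mult del: scaleR_minus_left flip: matrix_mul_assoc)
    have P_periodic: "P \<epsilon> (t + T) = P \<epsilon> t" if "\<epsilon> \<in> ball 0 r" for \<epsilon> t
    proof -
      have "mat_exp (- (t + T) *\<^sub>R F \<epsilon>) = mat_exp (- T *\<^sub>R F \<epsilon>) ** mat_exp (- t *\<^sub>R F \<epsilon>)"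
        using mat_exp_add_scaleR [of "- T" "- t" "F \<epsilon>"] by (simp add: algebra_simps)
      then have "P \<epsilon> (t + T)
          = X \<epsilon> t ** (mat_exp (T *\<^sub>R F \<epsilon>) ** mat_exp (- T *\<^sub>R F \<epsilon>)) ** mat_exp (- t *\<^sub>R F \<epsilon>)"
        by (simp add: P_def X_shift F_T [OF that] matrix_mul_assoc del: scaleR_minus_left)
      then show ?thesis
        using mat_exp_minus_mult [of "- T" "F \<epsilon>"] by (simp add: P_def)
    qed
    have "floquet_decomposition A0 A1 T (mat \<sigma>) P F"
      unfolding floquet_decomposition_def
    proof (intro conjI exI [of _ r] ballI allI)
      fix \<epsilon> assume "\<epsilon> \<in> ball (0::complex) r"
      then show "P \<epsilon> (t + T) = P \<epsilon> t" for t by (rule P_periodic)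
      show "fundamental_solution (\<lambda>t. A0 + mat \<epsilon> ** A1 t) (\<lambda>t. P \<epsilon> t ** mat_exp (t *\<^sub>R F \<epsilon>))"
        using X_sol [of \<epsilon>] by (simp add: PX A_def)
      show "P \<epsilon> 0 = mat 1"
        using X_sol [of \<epsilon>] by (simp add: P_def mat_exp_0 fundamental_solution_def)
    next
      fix t i j
      have "(\<lambda>\<epsilon>. mat_exp (- t *\<^sub>R F \<epsilon>) $ i $ j) holomorphic_on ball 0 r" for i j
        by (intro mat_exp_holomorphic)
          (simp add: scaleR_conv_of_real [where 'a = complex], intro holomorphic_intros F_hol)
      moreover have "(\<lambda>\<epsilon>. Y \<epsilon> t $ i $ j) holomorphic_on ball 0 r" for i j
        using Y_hol [rule_format] by (rule holomorphic_on_subset) auto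
      ultimately show "(\<lambda>\<epsilon>. P \<epsilon> t $ i $ j) holomorphic_on ball 0 r"
        unfolding P_def X_def matrix2_mult_nth by (intro holomorphic_intros)
    next
      fix t
      have "t *\<^sub>R (A0 - mat \<sigma>) = mat (- of_real t * \<sigma>) + t *\<^sub>R A0"
        by (simp add: scaleR_diff_right) (simp add: scaleR_matrix mat_mult_mat vec_eq_iff mat_nth)
      then have "mat_exp (t *\<^sub>R (A0 - mat \<sigma>)) = mat (exp (- of_real t * \<sigma>)) ** E t"
        by (simp add: mat_exp_scalar_add E_def)
      moreover have "mat_exp (- t *\<^sub>R F 0) = mat (exp (- of_real t * \<sigma>))"
        using mat_exp_scalar_add [of "- of_real t * \<sigma>" 0]
        by (simp add: F0 mat_exp_0 scaleR_matrix mat_mult_mat)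
      ultimately show "P 0 t = mat_exp (t *\<^sub>R (A0 - mat \<sigma>))"
        by (simp add: P_def X_def Y_0 mat_mult_commute)
    qed (use \<open>r > 0\<close> F_hol F0 in auto)
    then show ?thesis by blast
  qed
  show "T *\<^sub>R first_order_coeff F = G T - G 0"
    if decomp: "floquet_decomposition A0 A1 T (mat \<sigma>) P F"
      and G: "\<And>t. (G has_vector_derivative mat_exp (- t *\<^sub>R A0) ** A1 t ** mat_exp (t *\<^sub>R A0)) (at t)"
    for P F G
  proof -
    obtain r where "r > 0"
      and sol: "\<And>\<epsilon>. \<epsilon> \<in> ball 0 r \<Longrightarrow> fundamental_solution (A \<epsilon>) (\<lambda>t. P \<epsilon> t ** mat_exp (t *\<^sub>R F \<epsilon>))"
      and P_per: "\<And>\<epsilon> t. \<epsilon> \<in> ball 0 r \<Longrightarrow> P \<epsilon> (t + T) = P \<epsilon> t"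
      and P_0: "\<And>\<epsilon>. \<epsilon> \<in> ball 0 r \<Longrightarrow> P \<epsilon> 0 = mat 1"
      and F_hol: "\<And>i j. (\<lambda>\<epsilon>. F \<epsilon> $ i $ j) holomorphic_on ball 0 r"
      and F0: "F 0 = mat \<sigma>"
      using decomp unfolding floquet_decomposition_def A_def by blast
    have monodromy: "mat_exp (T *\<^sub>R F \<epsilon>) = mat (exp (of_real T * \<sigma>)) ** Y \<epsilon> T" if "\<epsilon> \<in> ball 0 r" for \<epsilon>
      using X_unique [OF sol [OF that], of T] P_per [OF that, of 0] P_0 [OF that] by (simp add: X_T)
    have "(T *\<^sub>R first_order_coeff F) $ i $ j = Y1 T $ i $ j" for i j
    proof -
      have "((\<lambda>\<epsilon>. F \<epsilon> $ i $ j) has_field_derivative first_order_coeff F $ i $ j) (at 0)" for i j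
        using holomorphic_derivI [OF F_hol open_ball, of 0] \<open>r > 0\<close> by (simp add: first_order_coeff_def)
      then have "((\<lambda>\<epsilon>. (T *\<^sub>R F \<epsilon>) $ i $ j) has_field_derivative (T *\<^sub>R first_order_coeff F) $ i $ j) (at 0)" for i j
        by (simp add: scaleR_conv_of_real [where 'a = complex] DERIV_cmult)
      moreover have "T *\<^sub>R F 0 = mat (of_real T * \<sigma>)"
        by (simp add: F0 scaleR_matrix mat_mult_mat)
      ultimately have "((\<lambda>\<epsilon>. mat_exp (T *\<^sub>R F \<epsilon>) $ i $ j) has_field_derivative
          exp (of_real T * \<sigma>) * (T *\<^sub>R first_order_coeff F) $ i $ j) (at 0)"
        by (rule mat_exp_deriv_scalar)
      then have "((\<lambda>\<epsilon>. exp (of_real T * \<sigma>) * Y \<epsilon> T $ i $ j) has_field_derivative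
          exp (of_real T * \<sigma>) * (T *\<^sub>R first_order_coeff F) $ i $ j) (at 0)"
        by (rule has_field_derivative_transform_within_open [OF _ open_ball [of 0 r]])
           (use \<open>r > 0\<close> monodromy in \<open>auto simp: mat_mult_component\<close>)
      moreover have "((\<lambda>\<epsilon>. exp (of_real T * \<sigma>) * Y \<epsilon> T $ i $ j) has_field_derivative
          exp (of_real T * \<sigma>) * Y1 T $ i $ j) (at 0)"
        by (intro DERIV_cmult Y_deriv [rule_format])
      ultimately have "exp (of_real T * \<sigma>) * (T *\<^sub>R first_order_coeff F) $ i $ j
          = exp (of_real T * \<sigma>) * Y1 T $ i $ j"
        by (rule DERIV_unique)
      then show ?thesis unfolding mult_cancel_left using exp_not_eq_zero by blast
    qed
    then have "T *\<^sub>R first_order_coeff F = Y1 T" unfolding vec_eq_iff by blast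
    also have "\<dots> = G T - G 0"
    proof -
      have "((\<lambda>t. Y1 t - G t) has_vector_derivative 0) (at t)" for t
        using has_vector_derivative_diff [OF Y1(2) [rule_format] G, of t] by (simp add: B_def E_def E'_def)
      then obtain c where c: "Y1 t - G t = c" for t
        using has_vector_derivative_zero_constant [of UNIV "\<lambda>t. Y1 t - G t"] by force
      have "Y1 T - G T = Y1 0 - G 0" unfolding c ..
      then show ?thesis using Y1(1) by (simp add: diff_eq_eq)
    qed
    finally show ?thesis .
  qed
qed

section \<open>The overdamped oscillator\<close>

text \<open>
  The eigenvalues of \<open>A\<^sub>0\<close> are real and distinct; folding shifts only imaginary parts, so \<open>F\<^sub>0\<close> has the
  same diagonal.
\<close>

lemma oscillator_overdamped:
  fixes c k T :: real
  assumes "c\<^sup>2 > 4 * k" "T > 0"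
  shows "\<not> first_order_asymptotic_EP (osc_A0 c k) A1 T"
proof
  assume "first_order_asymptotic_EP (osc_A0 c k) A1 T"
  then obtain F0 F where F0: "folded_exponent (osc_A0 c k) T F0"
    and nd: "\<And>\<epsilon>::real. \<epsilon> > 0 \<Longrightarrow> \<not> diagonalizable (F0 + \<epsilon> *\<^sub>R first_order_coeff F)"
    unfolding first_order_asymptotic_EP_def by blast
  define s where "s = sqrt (c\<^sup>2 - 4 * k)"
  have "s > 0" using assms by (simp add: s_def)
  have \<alpha>: "osc_alpha c k = of_real s"
    using assms by (simp add: osc_alpha_def s_def csqrt_of_real)
  have Im_A0: "Im (osc_A0 c k $ i $ i) = 0" for i
    using exhaust_2 [of i] by (auto simp: osc_A0_def Let_def \<alpha>)
  have F0_eq: "F0 $ i $ i = osc_A0 c k $ i $ i" for i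
  proof -
    obtain m :: int where m: "(osc_A0 c k - F0) $ i $ i = 2 * of_real pi * \<i> / of_real T * of_int m"
      and Im: "Im (F0 $ i $ i) \<in> {- pi / T <.. pi / T}"
      using F0 unfolding folded_exponent_def by blast
    have "Im (F0 $ i $ i) = - (2 * pi / T * m)"
      using arg_cong [OF m, of Im] Im_A0 [of i] by (simp add: Im_divide_of_real)
    then have "- pi / T < - (2 * m) * (pi / T)" "- (2 * m) * (pi / T) \<le> 1 * (pi / T)"
      using Im by (simp_all add: field_simps)
    then have "(- 1) * (pi / T) < - (2 * m) * (pi / T)" "- (2 * m) * (pi / T) \<le> 1 * (pi / T)"
      by simp_all
    moreover have "pi / T > 0" using \<open>T > 0\<close> by simp
    ultimately have "(- 1 :: real) < - (2 * m)" "- (2 * m) \<le> (1 :: real)"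
      by (simp_all only: mult_less_cancel_right_pos mult_le_cancel_right_pos)
    then have "m = 0" by linarith
    then show ?thesis using m by simp
  qed
  have "F0 $ 1 $ 1 \<noteq> F0 $ 2 $ 2"
    using \<open>s > 0\<close> by (simp add: F0_eq osc_A0_def Let_def \<alpha> field_simps)
  then show False
    using diagonalizable_perturbed_distinct [of F0 "first_order_coeff F"] F0 nd
    by (auto simp: folded_exponent_def)
qed

section \<open>The underdamped oscillator\<close>

lemma osc_alpha_underdamped:
  assumes "c\<^sup>2 < 4 * k"
  shows "osc_alpha c k = \<i> * complex_of_real (sqrt (4 * k - c\<^sup>2))"
  using assms by (simp add: osc_alpha_def csqrt_of_real_nonpos del: csqrt.simps)

text \<open>
  The imaginary parts of the eigenvalues of \<open>A\<^sub>0\<close> are \<open>- \<omega> / 2\<close> and \<open>\<omega> / 2\<close>, the two end points of the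
  folding interval, which has length \<open>\<omega>\<close> and contains only its right end point.  So the first eigenvalue
  is shifted onto the second one.
\<close>

lemma folded_exponent_underdamped:
  fixes c k T :: real and \<alpha> :: complex
  assumes "c\<^sup>2 < 4 * k"
  defines "\<omega> \<equiv> sqrt (4 * k - c\<^sup>2)"
  defines "T \<equiv> 2 * pi / \<omega>" and "\<alpha> \<equiv> \<i> * of_real \<omega>"
  shows "folded_exponent (osc_A0 c k) T F0 \<longleftrightarrow> F0 = mat ((\<alpha> - c) / 2)"
proof -
  have "\<omega> > 0" using assms(1) by (simp add: \<omega>_def)
  have osc_\<alpha>: "osc_alpha c k = \<alpha>"
    using osc_alpha_underdamped [OF assms(1)] by (simp add: \<alpha>_def \<omega>_def)
  have half: "pi / T = \<omega> / 2" using \<open>\<omega> > 0\<close> by (simp add: T_def)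
  have unit: "2 * of_real pi * \<i> / of_real T = \<alpha>"
    using \<open>\<omega> > 0\<close> by (simp add: T_def \<alpha>_def)
  define \<mu> :: "2 \<Rightarrow> complex" where "\<mu> = (\<lambda>i. if i = 1 then - (c + \<alpha>) / 2 else - (c - \<alpha>) / 2)"
  have \<mu>: "osc_A0 c k $ i $ i = \<mu> i" for i
    using exhaust_2 [of i] by (auto simp: osc_A0_def Let_def osc_\<alpha> \<mu>_def)
  have unique: "(\<exists>m::int. \<mu> i - z = \<alpha> * of_int m) \<and> Im z \<in> {- (\<omega> / 2) <.. \<omega> / 2} \<longleftrightarrow> z = (\<alpha> - c) / 2"
    for z i
  proof
    assume "(\<exists>m::int. \<mu> i - z = \<alpha> * of_int m) \<and> Im z \<in> {- (\<omega> / 2) <.. \<omega> / 2}"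
    then obtain m :: int where m: "\<mu> i - z = \<alpha> * of_int m"
      and Im: "- (\<omega> / 2) < Im z" "Im z \<le> \<omega> / 2" by auto
    have "Im (\<mu> i) - Im z = \<omega> * m" using arg_cong [OF m, of Im] by (simp add: \<alpha>_def)
    show "z = (\<alpha> - c) / 2"
    proof (cases "i = 1")
      case True
      then have "Im z = \<omega> * (- 1 / 2 - m)"
        using \<open>Im (\<mu> i) - Im z = \<omega> * m\<close> by (simp add: \<mu>_def \<alpha>_def algebra_simps)
      with Im have "\<omega> * (- 1 / 2) < \<omega> * (- 1 / 2 - m)" "\<omega> * (- 1 / 2 - m) \<le> \<omega> * (1 / 2)"
        by simp_all
      then have "- 1 / 2 < - 1 / 2 - real_of_int m" "- 1 / 2 - real_of_int m \<le> 1 / 2"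
        using \<open>\<omega> > 0\<close> by (simp_all only: mult_less_cancel_left_pos mult_le_cancel_left_pos)
      \<comment> \<open>The value \<open>m = 0\<close> would give the excluded left end point.\<close>
      then have "m = - 1" by linarith
      with m True show ?thesis by (simp add: \<mu>_def field_simps)
    next
      case False
      then have "Im z = \<omega> * (1 / 2 - m)"
        using \<open>Im (\<mu> i) - Im z = \<omega> * m\<close> by (simp add: \<mu>_def \<alpha>_def algebra_simps)
      with Im have "\<omega> * (- 1 / 2) < \<omega> * (1 / 2 - m)" "\<omega> * (1 / 2 - m) \<le> \<omega> * (1 / 2)"
        by simp_all
      then have "- 1 / 2 < 1 / 2 - real_of_int m" "1 / 2 - real_of_int m \<le> 1 / 2"
        using \<open>\<omega> > 0\<close> by (simp_all only: mult_less_cancel_left_pos mult_le_cancel_left_pos)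
      then have "m = 0" by linarith
      with m False show ?thesis by (simp add: \<mu>_def)
    qed
  next
    assume z: "z = (\<alpha> - c) / 2"
    have "\<mu> i - z = \<alpha> * of_int (if i = 1 then - 1 else 0)"
      by (simp add: z \<mu>_def field_simps)
    moreover have "Im z \<in> {- (\<omega> / 2) <.. \<omega> / 2}" using \<open>\<omega> > 0\<close> by (simp add: z \<alpha>_def)
    ultimately show "(\<exists>m::int. \<mu> i - z = \<alpha> * of_int m) \<and> Im z \<in> {- (\<omega> / 2) <.. \<omega> / 2}" by blast
  qed
  have "folded_exponent (osc_A0 c k) T F0
      \<longleftrightarrow> diagonal F0 \<and> (\<forall>i. F0 $ i $ i = (\<alpha> - c) / 2)"
    unfolding folded_exponent_def unit half minus_divide_left [symmetric] half vector_minus_component \<mu> unique ..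
  also have "\<dots> \<longleftrightarrow> F0 = mat ((\<alpha> - c) / 2)"
    by (auto simp: diagonal_def vec_eq_iff mat_nth)
  finally show ?thesis .
qed

lemma trigonometric_primitive:
  fixes m x y :: complex and \<nu> T :: real
  assumes "\<nu> \<noteq> 0" "exp (\<i> * \<nu> * T) = 1"
  obtains g where
    "\<forall>t. (g has_vector_derivative m + x * exp (\<i> * \<nu> * t) + y * exp (- (\<i> * \<nu> * t))) (at t)"
    "g T - g 0 = T * m"
proof -
  define g where "g = (\<lambda>z::complex. m * z + x * exp (\<i> * \<nu> * z) / (\<i> * \<nu>)
                               - y * exp (- (\<i> * \<nu> * z)) / (\<i> * \<nu>))"
  have "(g has_field_derivative m + x * exp (\<i> * \<nu> * z) + y * exp (- (\<i> * \<nu> * z))) (at z)" for z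
    unfolding g_def using assms(1)
    by (auto intro!: derivative_eq_intros simp: field_simps)
  then have "((\<lambda>t. g (of_real t)) has_vector_derivative
      m + x * exp (\<i> * \<nu> * t) + y * exp (- (\<i> * \<nu> * t))) (at t)" for t :: real
    by (intro has_vector_derivative_real_field)
  moreover have "g (of_real T) - g (of_real 0) = T * m"
    using assms(2) by (simp add: g_def exp_minus mult.commute)
  ultimately show ?thesis by (intro that [of "\<lambda>t. g (of_real t)"]) auto
qed

lemma cos_exp_of_real:
  "complex_of_real (cos (x + \<phi>))
    = (exp (\<i> * \<phi>) * exp (\<i> * x) + exp (- (\<i> * \<phi>)) * exp (- (\<i> * x))) / 2"
  by (simp add: cos_of_real [symmetric] cos_exp_eq exp_add [symmetric] algebra_simps)

text \<open>
  The signal \<open>s\<close> has mean zero over a period.  After multiplication by \<open>exp (\<i> \<omega> t)\<close> only the summand of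
  frequency \<open>- \<omega>\<close> contributes to the mean, and after multiplication by \<open>exp (- \<i> \<omega> t)\<close> only the summand
  of frequency \<open>\<omega>\<close>.
\<close>

lemma resonant_trigonometric_primitives:
  fixes u v :: complex and \<omega> \<phi> T :: real
  assumes "\<omega> \<noteq> 0" "exp (\<i> * \<omega> * T) = 1"
  defines "s \<equiv> \<lambda>t. u * cos (\<omega> * t + \<phi>) + v * cos (\<omega> * t)"
  shows "\<exists>g. (\<forall>t. (g has_vector_derivative s t) (at t)) \<and> g T - g 0 = 0"
    and "\<exists>g. (\<forall>t. (g has_vector_derivative exp (\<i> * \<omega> * t) * s t) (at t))
            \<and> g T - g 0 = T * ((u * exp (- (\<i> * \<phi>)) + v) / 2)"
    and "\<exists>g. (\<forall>t. (g has_vector_derivative exp (- (\<i> * \<omega> * t)) * s t) (at t))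
            \<and> g T - g 0 = T * ((u * exp (\<i> * \<phi>) + v) / 2)"
proof -
  define x where "x = (u * exp (\<i> * \<phi>) + v) / 2"
  define y where "y = (u * exp (- (\<i> * \<phi>)) + v) / 2"
  have s: "s t = 0 + x * exp (\<i> * \<omega> * t) + y * exp (- (\<i> * \<omega> * t))" for t
  proof -
    have "complex_of_real (cos (\<omega> * t)) = (exp (\<i> * \<omega> * t) + exp (- (\<i> * \<omega> * t))) / 2"
      using cos_exp_of_real [of "\<omega> * t" 0] by (simp add: mult.assoc)
    moreover have "complex_of_real (cos (\<omega> * t + \<phi>))
        = (exp (\<i> * \<phi>) * exp (\<i> * \<omega> * t) + exp (- (\<i> * \<phi>)) * exp (- (\<i> * \<omega> * t))) / 2"
      using cos_exp_of_real [of "\<omega> * t" \<phi>] by (simp add: mult.assoc)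
    ultimately show ?thesis
      unfolding s_def x_def y_def by (simp only:) (simp add: algebra_simps add_divide_distrib)
  qed
  have double: "exp (\<i> * of_real (2 * \<omega>) * t) = exp (\<i> * \<omega> * t) * exp (\<i> * \<omega> * t)"
    "exp (- (\<i> * of_real (2 * \<omega>) * t)) = exp (- (\<i> * \<omega> * t)) * exp (- (\<i> * \<omega> * t))" for t :: real
    by (simp_all add: algebra_simps flip: exp_add)
  have inverse: "exp (\<i> * \<omega> * t) * exp (- (\<i> * \<omega> * t)) = 1" for t :: real
    by (simp flip: exp_add)
  have s_plus: "exp (\<i> * \<omega> * t) * s t
      = y + x * exp (\<i> * of_real (2 * \<omega>) * t) + 0 * exp (- (\<i> * of_real (2 * \<omega>) * t))" for t
  proof -
    have "exp (\<i> * \<omega> * t) * s t = x * (exp (\<i> * \<omega> * t) * exp (\<i> * \<omega> * t))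
        + y * (exp (\<i> * \<omega> * t) * exp (- (\<i> * \<omega> * t)))"
      by (simp add: s distrib_left mult_ac)
    then show ?thesis unfolding double by (simp add: inverse)
  qed
  have s_minus: "exp (- (\<i> * \<omega> * t)) * s t
      = x + 0 * exp (\<i> * of_real (2 * \<omega>) * t) + y * exp (- (\<i> * of_real (2 * \<omega>) * t))" for t
  proof -
    have "exp (- (\<i> * \<omega> * t)) * s t = x * (exp (\<i> * \<omega> * t) * exp (- (\<i> * \<omega> * t)))
        + y * (exp (- (\<i> * \<omega> * t)) * exp (- (\<i> * \<omega> * t)))"
      by (simp add: s distrib_left mult_ac)
    then show ?thesis unfolding double by (simp add: inverse)
  qed
  \<comment> \<open>The products contain a constant and an oscillation of frequency \<open>2 * \<omega>\<close>.\<close>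
  have "2 * \<omega> \<noteq> 0" "exp (\<i> * of_real (2 * \<omega>) * T) = 1"
    unfolding double using assms by simp_all
  note primitive = trigonometric_primitive [OF this]
  show "\<exists>g. (\<forall>t. (g has_vector_derivative s t) (at t)) \<and> g T - g 0 = 0"
    unfolding s by (rule trigonometric_primitive [OF assms(1,2), of 0 x y]) auto
  show "\<exists>g. (\<forall>t. (g has_vector_derivative exp (\<i> * \<omega> * t) * s t) (at t))
      \<and> g T - g 0 = T * ((u * exp (- (\<i> * \<phi>)) + v) / 2)"
    unfolding s_plus y_def [symmetric] by (rule primitive [of y x 0]) blast
  show "\<exists>g. (\<forall>t. (g has_vector_derivative exp (- (\<i> * \<omega> * t)) * s t) (at t))
      \<and> g T - g 0 = T * ((u * exp (\<i> * \<phi>) + v) / 2)"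
    unfolding s_minus x_def [symmetric] by (rule primitive [of x 0 y]) blast
qed

text \<open>
  Conjugation with the diagonal matrix \<open>exp (t A\<^sub>0)\<close> leaves the diagonal of \<open>A\<^sub>1\<close> unchanged and multiplies
  the off-diagonal entries by \<open>exp (\<i> \<omega> t)\<close> and \<open>exp (- \<i> \<omega> t)\<close>.  Every entry of \<open>A\<^sub>1\<close> is a combination of
  the two signals of frequency \<open>\<omega>\<close>, so the diagonal averages out and the off-diagonal means are
  those of the previous lemma.
\<close>

lemma oscillator_resonant:
  fixes c k \<phi> :: real and \<alpha> :: complex
  assumes "c\<^sup>2 < 4 * k"
  defines "\<omega> \<equiv> sqrt (4 * k - c\<^sup>2)"
  defines "T \<equiv> 2 * pi / \<omega>" and "\<alpha> \<equiv> \<i> * of_real \<omega>"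
  defines "\<sigma> \<equiv> (\<alpha> - c) / 2"
  shows oscillator_resonant_decomposition:
      "\<exists>P F. floquet_decomposition (osc_A0 c k) (osc_A1 c k \<phi> 1 1 T) T (mat \<sigma>) P F"
    and oscillator_resonant_coefficient:
      "\<And>P F. floquet_decomposition (osc_A0 c k) (osc_A1 c k \<phi> 1 1 T) T (mat \<sigma>) P F \<Longrightarrow>
        first_order_coeff F = vector
          [vector [0, (c + \<alpha>) / (4 * \<alpha>) * ((c + \<alpha>) * exp (- (\<i> * \<phi>)) / (2 * k) - 1)],
           vector [(c - \<alpha>) / (4 * \<alpha>) * ((c - \<alpha>) * exp (\<i> * \<phi>) / (2 * k) + 1), 0]]"
proof -
  define \<mu>1 \<mu>2 where "\<mu>1 = - (c + \<alpha>) / 2" and "\<mu>2 = - (c - \<alpha>) / 2"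
  define f f' where "f = exp (\<i> * \<phi>)" and "f' = exp (- (\<i> * \<phi>))"
  have "\<omega> > 0" "\<omega> \<noteq> 0" using assms(1) by (simp_all add: \<omega>_def)
  have "\<alpha> \<noteq> 0" using \<open>\<omega> > 0\<close> by (simp add: \<alpha>_def)
  have osc_\<alpha>: "osc_alpha c k = \<alpha>"
    using osc_alpha_underdamped [OF assms(1)] by (simp add: \<alpha>_def \<omega>_def)
  have "T > 0" using \<open>\<omega> > 0\<close> by (simp add: T_def)
  have \<omega>T: "\<omega> * T = 2 * pi" using \<open>\<omega> > 0\<close> by (simp add: T_def)
  then have freq: "2 * pi / T = \<omega>" using \<open>T > 0\<close> by (simp add: field_simps)
  have exp_T: "exp (\<i> * \<omega> * T) = 1"
  proof -
    have eq: "\<i> * \<omega> * T = 2 * of_real pi * \<i>"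
      using arg_cong [OF \<omega>T, of complex_of_real] by (simp add: mult_ac)
    show ?thesis unfolding eq by (rule exp_two_pi_i)
  qed
  define S :: "complex \<Rightarrow> complex \<Rightarrow> real \<Rightarrow> complex"
    where "S = (\<lambda>(u::complex) (v::complex) t. u * cos (\<omega> * t + \<phi>) + v * cos (\<omega> * t))"
  define u11 where "u11 = 1 / \<alpha>"
  define u12 where "u12 = (c + \<alpha>)\<^sup>2 / (4 * k) / \<alpha>"
  define u21 where "u21 = (c - \<alpha>)\<^sup>2 / (4 * k) / \<alpha>"
  define u22 where "u22 = - 1 / \<alpha>"
  define v1 where "v1 = (- 1 - c / \<alpha>) / 2"
  define v2 where "v2 = (- 1 + c / \<alpha>) / 2"
  define A1 where "A1 = osc_A1 c k \<phi> 1 1 T"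
  have signals: "osc_kappa 1 \<phi> T t = cos (\<omega> * t + \<phi>)" "osc_zeta 1 T t = cos (\<omega> * t)" for t
    unfolding osc_kappa_def osc_zeta_def freq by simp_all
  have A1: "A1 t $ 1 $ 1 = S u11 v1 t" "A1 t $ 1 $ 2 = S u12 v1 t"
    "A1 t $ 2 $ 1 = S u21 v2 t" "A1 t $ 2 $ 2 = S u22 v2 t" for t
    by (simp_all add: A1_def osc_A1_def Let_def osc_\<alpha> mat_mult_component signals
        S_def u11_def u12_def u21_def u22_def v1_def v2_def mult_ac del: One_nat_def)
  have A0: "osc_A0 c k $ 1 $ 1 = \<mu>1" "osc_A0 c k $ 1 $ 2 = 0"
    "osc_A0 c k $ 2 $ 1 = 0" "osc_A0 c k $ 2 $ 2 = \<mu>2"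
    by (simp_all add: osc_A0_def Let_def osc_\<alpha> \<mu>1_def \<mu>2_def)
  have exp_A0: "mat_exp (t *\<^sub>R osc_A0 c k)
      = vector [vector [exp (t * \<mu>1), 0], vector [0, exp (t * \<mu>2)]]" for t :: real
    by (subst mat_exp_diagonal) (simp_all add: A0 scaleR_conv_of_real [where 'a = complex])
  have resonant: "mat_exp (T *\<^sub>R osc_A0 c k) = mat (exp (T * \<sigma>))"
  proof -
    have "T * \<mu>1 = T * \<sigma> - \<i> * \<omega> * T" "\<mu>2 = \<sigma>"
      by (simp_all add: \<mu>1_def \<mu>2_def \<sigma>_def \<alpha>_def field_simps)
    then show ?thesis
      using exp_T by (simp add: exp_A0 matrix2_eq_iff mat_nth exp_diff)
  qed
  have cont: "continuous_on UNIV A1"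
  proof -
    have "continuous_on UNIV (S u v)" for u v
      unfolding S_def by (intro continuous_intros)
    then have "continuous_on UNIV (\<lambda>t. A1 t $ i $ j)" for i j
      using exhaust_2 [of i] exhaust_2 [of j] by (auto simp: A1)
    then have "continuous_on UNIV (\<lambda>t. \<chi> i j. A1 t $ i $ j)"
      by (intro continuous_on_vec_lambda)
    then show ?thesis by simp
  qed
  have periodic: "A1 (t + T) = A1 t" for t
  proof -
    have "cos (\<omega> * (t + T) + x) = cos (\<omega> * t + x)" for x
      using cos_periodic [of "\<omega> * t + x"] by (simp add: distrib_left \<omega>T add_ac)
    from this [of \<phi>] this [of 0] show ?thesis by (simp add: matrix2_eq_iff A1 S_def)
  qed
  define B where "B = (\<lambda>t. mat_exp (- t *\<^sub>R osc_A0 c k) ** A1 t ** mat_exp (t *\<^sub>R osc_A0 c k))"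
  have B: "B t $ 1 $ 1 = S u11 v1 t" "B t $ 2 $ 2 = S u22 v2 t"
    "B t $ 1 $ 2 = exp (\<i> * \<omega> * t) * S u12 v1 t" "B t $ 2 $ 1 = exp (- (\<i> * \<omega> * t)) * S u21 v2 t" for t
  proof -
    have conj: "exp (- x) * z * exp y = exp (y - x) * z" for x y z :: complex
      by (simp add: exp_diff exp_minus field_simps)
    have diff: "t * \<mu>2 - t * \<mu>1 = \<i> * \<omega> * t" "t * \<mu>1 - t * \<mu>2 = - (\<i> * \<omega> * t)"
      by (simp_all add: \<mu>1_def \<mu>2_def \<alpha>_def field_simps)
    have entries: "B t $ 1 $ 1 = exp (- (t * \<mu>1)) * A1 t $ 1 $ 1 * exp (t * \<mu>1)"
      "B t $ 1 $ 2 = exp (- (t * \<mu>1)) * A1 t $ 1 $ 2 * exp (t * \<mu>2)"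
      "B t $ 2 $ 1 = exp (- (t * \<mu>2)) * A1 t $ 2 $ 1 * exp (t * \<mu>1)"
      "B t $ 2 $ 2 = exp (- (t * \<mu>2)) * A1 t $ 2 $ 2 * exp (t * \<mu>2)"
      unfolding B_def exp_A0 by (simp_all add: matrix2_mult_nth)
    show "B t $ 1 $ 1 = S u11 v1 t" "B t $ 2 $ 2 = S u22 v2 t"
      "B t $ 1 $ 2 = exp (\<i> * \<omega> * t) * S u12 v1 t" "B t $ 2 $ 1 = exp (- (\<i> * \<omega> * t)) * S u21 v2 t"
      unfolding entries conj diff A1 by simp_all
  qed
  note primitives = resonant_trigonometric_primitives [OF \<open>\<omega> \<noteq> 0\<close> exp_T, of _ \<phi>]
  have S_eq: "S u v t = u * cos (\<omega> * t + \<phi>) + v * cos (\<omega> * t)" for u v t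
    by (simp add: S_def)
  obtain g11 where g11: "\<forall>t. (g11 has_vector_derivative B t $ 1 $ 1) (at t)" "g11 T - g11 0 = 0"
    using primitives(1) [of u11 v1] unfolding B S_eq by blast
  obtain g22 where g22: "\<forall>t. (g22 has_vector_derivative B t $ 2 $ 2) (at t)" "g22 T - g22 0 = 0"
    using primitives(1) [of u22 v2] unfolding B S_eq by blast
  obtain g12 where g12: "\<forall>t. (g12 has_vector_derivative B t $ 1 $ 2) (at t)"
      "g12 T - g12 0 = T * ((u12 * f' + v1) / 2)"
    using primitives(2) [of u12 v1] unfolding B f'_def S_eq by blast
  obtain g21 where g21: "\<forall>t. (g21 has_vector_derivative B t $ 2 $ 1) (at t)"
      "g21 T - g21 0 = T * ((u21 * f + v2) / 2)"
    using primitives(3) [of u21 v2] unfolding B f_def S_eq by blast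
  define G :: "real \<Rightarrow> complex^2^2" where "G = (\<lambda>t. vector [vector [g11 t, g12 t], vector [g21 t, g22 t]])"
  have G: "(G has_vector_derivative B t) (at t)" for t
  proof (rule has_vector_derivative_vecI, rule has_vector_derivative_vecI)
    fix i j :: 2
    show "((\<lambda>t. G t $ i $ j) has_vector_derivative B t $ i $ j) (at t)"
      using exhaust_2 [of i] exhaust_2 [of j] g11(1) g12(1) g21(1) g22(1) by (auto simp: G_def)
  qed
  show "\<exists>P F. floquet_decomposition (osc_A0 c k) (osc_A1 c k \<phi> 1 1 T) T (mat \<sigma>) P F"
    using floquet_decomposition_exists [OF \<open>T > 0\<close> resonant cont periodic] unfolding A1_def .
  fix P F
  assume decomp: "floquet_decomposition (osc_A0 c k) (osc_A1 c k \<phi> 1 1 T) T (mat \<sigma>) P F"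
  have average: "T *\<^sub>R first_order_coeff F = G T - G 0"
    by (rule first_order_coeff_eq_average [OF \<open>T > 0\<close> resonant cont periodic])
       (use decomp G in \<open>simp_all add: A1_def B_def\<close>)
  have entry: "T * first_order_coeff F $ i $ j = G T $ i $ j - G 0 $ i $ j" for i j
    using arg_cong [OF average, of "\<lambda>M. M $ i $ j"] by (simp add: scaleR_conv_of_real [where 'a = complex])
  have gen: "(w\<^sup>2 / of_real (4 * k) / \<alpha> * x + - w / (2 * \<alpha>)) / 2
      = w / (4 * \<alpha>) * (w * x / of_real (2 * k) - 1)"
    "(w\<^sup>2 / of_real (4 * k) / \<alpha> * x + w / (2 * \<alpha>)) / 2
      = w / (4 * \<alpha>) * (w * x / of_real (2 * k) + 1)" for w x :: complex
    by (simp_all add: right_diff_distrib distrib_left diff_divide_distrib add_divide_distrib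
        power2_eq_square mult_ac)
  have "first_order_coeff F $ 1 $ 1 = 0" "first_order_coeff F $ 2 $ 2 = 0"
    using entry [of 1 1] entry [of 2 2] g11(2) g22(2) \<open>T > 0\<close> by (simp_all add: G_def)
  moreover have "first_order_coeff F $ 1 $ 2 = (u12 * f' + v1) / 2"
  proof -
    have "T * first_order_coeff F $ 1 $ 2 = T * ((u12 * f' + v1) / 2)"
      using entry [of 1 2] g12(2) by (simp add: G_def)
    then show ?thesis using \<open>T > 0\<close> unfolding mult_cancel_left by simp
  qed
  moreover have "first_order_coeff F $ 2 $ 1 = (u21 * f + v2) / 2"
  proof -
    have "T * first_order_coeff F $ 2 $ 1 = T * ((u21 * f + v2) / 2)"
      using entry [of 2 1] g21(2) by (simp add: G_def)
    then show ?thesis using \<open>T > 0\<close> unfolding mult_cancel_left by simp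
  qed
  moreover have "(u12 * f' + v1) / 2 = (c + \<alpha>) / (4 * \<alpha>) * ((c + \<alpha>) * f' / (2 * k) - 1)"
  proof -
    have "v1 = - (c + \<alpha>) / (2 * \<alpha>)" using \<open>\<alpha> \<noteq> 0\<close> by (simp add: v1_def field_simps)
    then show ?thesis by (simp only: u12_def gen)
  qed
  moreover have "(u21 * f + v2) / 2 = (c - \<alpha>) / (4 * \<alpha>) * ((c - \<alpha>) * f / (2 * k) + 1)"
  proof -
    have "v2 = (c - \<alpha>) / (2 * \<alpha>)" using \<open>\<alpha> \<noteq> 0\<close> by (simp add: v2_def field_simps)
    then show ?thesis by (simp only: u21_def gen)
  qed
  ultimately show "first_order_coeff F = vector
      [vector [0, (c + \<alpha>) / (4 * \<alpha>) * ((c + \<alpha>) * exp (- (\<i> * \<phi>)) / (2 * k) - 1)],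
       vector [(c - \<alpha>) / (4 * \<alpha>) * ((c - \<alpha>) * exp (\<i> * \<phi>) / (2 * k) + 1), 0]]"
    by (simp only: matrix2_eq_iff f_def f'_def vector_2 simp_thms)
qed

section \<open>Exceptional phases\<close>

text \<open>
  This turns a condition on \<open>\<phi>\<close> modulo \<open>2 * pi\<close> into a condition on \<open>exp (\<i> \<phi>)\<close>; the number \<open>w\<close> may be
  complex.
\<close>

lemma exp_i_eq_exp_i_iff:
  "exp (\<i> * of_real \<phi>) = exp (\<i> * w) \<longleftrightarrow> (\<exists>n::int. of_real \<phi> + 2 * of_real pi * of_int n = w)"
proof -
  have "exp (\<i> * of_real \<phi>) = exp (\<i> * w)
      \<longleftrightarrow> (\<exists>n::int. \<i> * w = \<i> * of_real \<phi> + of_real (of_int (2 * n) * pi) * \<i>)"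
    using exp_eq [of "\<i> * w" "\<i> * of_real \<phi>"] by (auto simp: eq_commute)
  also have "\<dots> \<longleftrightarrow> (\<exists>n::int. of_real \<phi> + 2 * of_real pi * of_int n = w)"
  proof (intro ex_cong1)
    fix n :: int
    have eq: "\<i> * of_real \<phi> + of_real (of_int (2 * n) * pi) * \<i>
        = \<i> * (of_real \<phi> + 2 * of_real pi * of_int n)"
      by (simp add: algebra_simps)
    show "(\<i> * w = \<i> * of_real \<phi> + of_real (of_int (2 * n) * pi) * \<i>)
        = (of_real \<phi> + 2 * of_real pi * of_int n = w)" for w
      unfolding eq mult_cancel_left by auto
  qed
  finally show ?thesis .
qed

lemma phase_condition:
  assumes "z \<noteq> 0" "w \<noteq> 0"
  shows "(\<exists>n::int. of_real \<phi> + 2 * of_real pi * of_int n \<in> {\<i> * Ln z, - \<i> * Ln w})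
    \<longleftrightarrow> exp (\<i> * of_real \<phi>) = 1 / z \<or> exp (\<i> * of_real \<phi>) = w"
proof -
  have "exp (\<i> * (\<i> * Ln z)) = 1 / z" "exp (\<i> * (- \<i> * Ln w)) = w"
    using assms by (simp_all add: exp_minus divide_inverse flip: mult.assoc)
  then show ?thesis
    using exp_i_eq_exp_i_iff [of \<phi> "\<i> * Ln z"] exp_i_eq_exp_i_iff [of \<phi> "- \<i> * Ln w"] by auto
qed

theorem lemma4p16:
  fixes c k \<phi> T :: real and a b :: nat
  assumes "c > 0" and "k > 0" and "c\<^sup>2 \<noteq> 4 * k"
    and "a > 0" and "b > 0" and "coprime a b" and "a = b"
    and "T = 2 * pi * real a / cmod (osc_alpha c k)"
  shows "first_order_asymptotic_EP (osc_A0 c k) (osc_A1 c k \<phi> a b T) T \<longleftrightarrow>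
    k = 1 \<and> c \<in> {0<..<2} \<and>
    (\<exists>n::int. complex_of_real \<phi> + 2 * of_real pi * of_int n \<in>
       {\<i> * Ln (2 * of_real k / (osc_alpha c k + of_real c)),
        - \<i> * Ln (2 * of_real k / (osc_alpha c k - of_real c))})"
proof -
  have ab: "a = 1" "b = 1" using assms by auto
  have "osc_alpha c k \<noteq> 0"
  proof -
    have "c\<^sup>2 - 4 * k \<noteq> 0" using assms(3) by simp
    then show ?thesis unfolding osc_alpha_def csqrt_eq_0 of_real_eq_0_iff .
  qed
  then have "T > 0" using assms by simp
  consider "c\<^sup>2 > 4 * k" | "c\<^sup>2 < 4 * k" using assms(3) by linarith
  then show ?thesis
  proof cases
    case 1
    have "\<not> (k = 1 \<and> c \<in> {0<..<2})"
    proof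
      assume "k = 1 \<and> c \<in> {0<..<2}"
      then have "c\<^sup>2 < 2\<^sup>2" by (intro power_strict_mono) auto
      with 1 \<open>k = 1 \<and> c \<in> {0<..<2}\<close> show False by simp
    qed
    with oscillator_overdamped [OF 1 \<open>T > 0\<close>] show ?thesis by blast
  next
    case 2
    define \<omega> where "\<omega> = sqrt (4 * k - c\<^sup>2)"
    define \<alpha> where "\<alpha> = \<i> * complex_of_real \<omega>"
    have "\<omega> > 0" using 2 by (simp add: \<omega>_def)
    have \<omega>2: "\<omega>\<^sup>2 = 4 * k - c\<^sup>2" using 2 by (simp add: \<omega>_def)
    have osc_\<alpha>: "osc_alpha c k = \<alpha>"
      using osc_alpha_underdamped [OF 2] by (simp add: \<alpha>_def \<omega>_def)
    have nz: "c + \<alpha> \<noteq> 0" "c - \<alpha> \<noteq> 0" "\<alpha> - c \<noteq> 0" "\<alpha> + c \<noteq> 0"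
      using assms(1) by (auto simp: \<alpha>_def complex_eq_iff)
    have T: "T = 2 * pi / \<omega>" using assms(8) \<open>\<omega> > 0\<close> by (simp add: ab osc_\<alpha> \<alpha>_def norm_mult)
    define \<sigma> where "\<sigma> = (\<alpha> - c) / 2"
    define f where "f = exp (\<i> * complex_of_real \<phi>)"
    define f' where "f' = exp (- (\<i> * complex_of_real \<phi>))"
    define p where "p = (c + \<alpha>) / (4 * \<alpha>) * ((c + \<alpha>) * f' / (2 * k) - 1)"
    define q where "q = (c - \<alpha>) / (4 * \<alpha>) * ((c - \<alpha>) * f / (2 * k) + 1)"
    have coeff: "first_order_coeff F = vector [vector [0, p], vector [q, 0]]"
      if "floquet_decomposition (osc_A0 c k) (osc_A1 c k \<phi> 1 1 T) T (mat \<sigma>) P F" for P F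
      using oscillator_resonant_coefficient [OF 2, of \<phi> P F] that
      by (simp only: T \<sigma>_def \<alpha>_def \<omega>_def p_def q_def f_def f'_def)
    obtain P0 F0 where "floquet_decomposition (osc_A0 c k) (osc_A1 c k \<phi> 1 1 T) T (mat \<sigma>) P0 F0"
      using oscillator_resonant_decomposition [OF 2, of \<phi>]
      by (auto simp: T \<sigma>_def \<alpha>_def \<omega>_def)
    then have "first_order_asymptotic_EP (osc_A0 c k) (osc_A1 c k \<phi> 1 1 T) T
        \<longleftrightarrow> (\<forall>\<epsilon>::real. \<epsilon> > 0 \<longrightarrow>
              \<not> diagonalizable (mat \<sigma> + \<epsilon> *\<^sub>R vector [vector [0, p], vector [q, 0]] :: complex^2^2))"
      unfolding first_order_asymptotic_EP_def
      using folded_exponent_underdamped [OF 2, folded \<omega>_def, folded T \<alpha>_def, folded \<sigma>_def] coeff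
      by metis
    also have "\<dots> \<longleftrightarrow> p * q = 0 \<and> (p \<noteq> 0 \<or> q \<noteq> 0)"
      by (rule not_diagonalizable_off_diagonal_iff)
    also have "\<dots> \<longleftrightarrow> k = 1 \<and> c \<in> {0<..<2} \<and> (f = (c + \<alpha>) / (2 * k) \<or> f = 2 * k / (\<alpha> - c))"
    proof -
      have "\<alpha> \<noteq> 0" using \<open>\<omega> > 0\<close> by (simp add: \<alpha>_def)
      have ff': "f * f' = 1" by (simp add: f_def f'_def flip: exp_add)
      have p0: "p = 0 \<longleftrightarrow> f = (c + \<alpha>) / (2 * k)"
      proof -
        have "p = 0 \<longleftrightarrow> (c + \<alpha>) * f' = 2 * k"
          using nz \<open>\<alpha> \<noteq> 0\<close> \<open>k > 0\<close> by (simp add: p_def)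
        also have "\<dots> \<longleftrightarrow> f = (c + \<alpha>) / (2 * k)"
        proof
          assume "(c + \<alpha>) * f' = 2 * k"
          then have "(c + \<alpha>) * (f * f') = 2 * k * f" by (simp add: mult_ac)
          then have "c + \<alpha> = 2 * k * f" by (simp only: ff' mult_1_right)
          then show "f = (c + \<alpha>) / (2 * k)" using \<open>k > 0\<close> by simp
        next
          assume "f = (c + \<alpha>) / (2 * k)"
          then have "(c + \<alpha>) = 2 * k * f" using \<open>k > 0\<close> by (simp add: field_simps)
          then have "(c + \<alpha>) * f' = 2 * k * (f * f')" by (simp add: mult_ac)
          then show "(c + \<alpha>) * f' = 2 * k" by (simp add: ff')
        qed
        finally show ?thesis .
      qed
      have q0: "q = 0 \<longleftrightarrow> f = 2 * k / (\<alpha> - c)"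
      proof -
        have "q = 0 \<longleftrightarrow> (c - \<alpha>) * f / (2 * k) + 1 = 0"
          using nz \<open>\<alpha> \<noteq> 0\<close> by (simp add: q_def)
        also have "\<dots> \<longleftrightarrow> f * (\<alpha> - c) = 2 * k"
          using \<open>k > 0\<close> by (auto simp: field_simps)
        also have "\<dots> \<longleftrightarrow> f = 2 * k / (\<alpha> - c)"
          using nz(3) by (simp add: eq_divide_eq)
        finally show ?thesis .
      qed
      \<comment> \<open>If both \<open>p\<close> and \<open>q\<close> vanished, the two formulas for \<open>f\<close> would make this product equal to \<open>(2 * k)\<^sup>2\<close>.\<close>
      have prod: "(c + \<alpha>) * (\<alpha> - c) = - (4 * k)"
      proof -
        have "\<alpha>\<^sup>2 = - complex_of_real (\<omega>\<^sup>2)" by (simp add: \<alpha>_def power_mult_distrib)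
        then show ?thesis unfolding \<omega>2 by (simp add: power2_eq_square algebra_simps)
      qed
      have not_both: "p \<noteq> 0 \<or> q \<noteq> 0"
      proof (rule ccontr)
        assume "\<not> (p \<noteq> 0 \<or> q \<noteq> 0)"
        then have "(c + \<alpha>) / (2 * k) = 2 * k / (\<alpha> - c)" using p0 q0 by simp
        then have "(c + \<alpha>) * (\<alpha> - c) = (2 * k) * (2 * k)"
          using nz(3) \<open>k > 0\<close> by (simp add: frac_eq_eq)
        then have "complex_of_real (- (4 * k)) = complex_of_real ((2 * k) * (2 * k))"
          using prod by simp
        then have "- (4 * k) = (2 * k) * (2 * k)" unfolding of_real_eq_iff .
        moreover have "(2 * k) * (2 * k) \<ge> 0" by simp
        ultimately show False using \<open>k > 0\<close> by linarith
      qed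
      have norm_plus: "(cmod (c + \<alpha>))\<^sup>2 = 4 * k" "(cmod (\<alpha> - c))\<^sup>2 = 4 * k"
        using \<omega>2 by (simp_all add: cmod_power2 \<alpha>_def)
      have "cmod f = 1" by (simp add: f_def)
      have k1: "k = 1" if "p = 0 \<or> q = 0"
      proof -
        have "4 * k = (2 * k)\<^sup>2"
          using that unfolding p0 q0
        proof
          assume "f = (c + \<alpha>) / (2 * k)"
          then have "c + \<alpha> = (2 * k) * f" using \<open>k > 0\<close> by simp
          then have "cmod (c + \<alpha>) = 2 * k"
            using \<open>cmod f = 1\<close> \<open>k > 0\<close> by (simp add: norm_mult)
          with norm_plus show ?thesis by simp
        next
          assume "f = 2 * k / (\<alpha> - c)"
          then have "f * (\<alpha> - c) = 2 * k" using nz(3) by simp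
          from arg_cong [OF this, of cmod] have "cmod (\<alpha> - c) = 2 * k"
            using \<open>cmod f = 1\<close> \<open>k > 0\<close> by (simp add: norm_mult)
          with norm_plus show ?thesis by simp
        qed
        then show "k = 1" using \<open>k > 0\<close> by (simp add: power2_eq_square)
      qed
      have c2: "c \<in> {0<..<2}" if "k = 1"
      proof -
        have "c\<^sup>2 < 2\<^sup>2" using 2 that by simp
        then have "c < 2" by (rule power_less_imp_less_base) simp
        with \<open>c > 0\<close> show ?thesis by simp
      qed
      show ?thesis
        using not_both k1 c2 unfolding mult_eq_0_iff p0 q0 by blast
    qed
    finally have EP: "first_order_asymptotic_EP (osc_A0 c k) (osc_A1 c k \<phi> 1 1 T) T
        \<longleftrightarrow> k = 1 \<and> c \<in> {0<..<2} \<and> (f = (c + \<alpha>) / (2 * k) \<or> f = 2 * k / (\<alpha> - c))" .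
    have phase: "f = (c + \<alpha>) / (2 * k) \<or> f = 2 * k / (\<alpha> - c)
        \<longleftrightarrow> (\<exists>n::int. of_real \<phi> + 2 * of_real pi * of_int n
              \<in> {\<i> * Ln (2 * k / (\<alpha> + c)), - \<i> * Ln (2 * k / (\<alpha> - c))})"
    proof -
      have "2 * k / (\<alpha> + c) \<noteq> 0" "2 * k / (\<alpha> - c) \<noteq> 0"
        using nz \<open>k > 0\<close> by simp_all
      from phase_condition [OF this, of \<phi>] show ?thesis
        by (simp add: f_def add.commute [of \<alpha>])
    qed
    show ?thesis unfolding ab osc_\<alpha> EP phase by simp
  qed
qed

end
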